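(* Let the training data points $x^{(k)}$ be sampled from a (potentially unknown) distribution $\mu$, with corresponding time derivatives $\dot x^{(k)}=F(x^{(k)})$. Dividing both sides of the QENDy systems $R\,v_\ell=s_\ell$, $\ell=1,\dots,N$, by the number of data points $m$ and letting $m\to\infty$, the entries converge as follows, where $i,j,i_1,i_2,j_1,j_2\in\{1,\dots,N\}$ and $\overline{ij}:=N(j-1)+i$: $$\left[\tfrac1m Z_2Z_2^\top\right]_{\overline{i_1i_2}\;\overline{j_1j_2}}\to\langle\phi_{i_1}\phi_{i_2},\phi_{j_1}\phi_{j_2}\rangle_\mu,\quad \left[\tfrac1m Z_2Z_1^\top\right]_{\overline{i_1i_2}\;j}\to\langle\phi_{i_1}\phi_{i_2},\phi_j\rangle_\mu,\quad \left[\tfrac1m Z_2\mathbf 1_m\right]_{\overline{i_1i_2}}\to\langle\phi_{i_1}\phi_{i_2},\mathbf 1\rangle_\mu,$$ $$\left[\tfrac1m Z_1Z_1^\top\right]_{ij}\to\langle\phi_i,\phi_j\rangle_\mu,\qquad \left[\tfrac1m Z_1\mathbf 1_m\right]_i\to\langle\phi_i,\mathbf 1\rangle_\mu,$$ $$\left[\tfrac1m Z_2\dot Z_\ell^\top\right]_{\overline{i_1i_2}}\to\langle\phi_{i_1}\phi_{i_2},\nabla\phi_\ell\cdot F\rangle_\mu,\quad \left[\tfrac1m Z_1\dot Z_\ell^\top\right]_i\to\langle\phi_i,\nabla\phi_\ell\cdot F\rangle_\mu,\quad \tfrac1m\mathbf 1_m^\top\dot Z_\ell^\top\to\langle\mathbf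 1,\nabla\phi_\ell\cdot F\rangle_\mu.$$ Overall, this results in the systems of linear equations $R^*v_\ell^*=s_\ell^*$ for $v_\ell^*=(A_\ell,B_\ell,C_\ell)^\top$, with $$R^*=\begin{bmatrix}\langle\phi_{i_1}\phi_{i_2},\phi_{j_1}\phi_{j_2}\rangle_\mu&\langle\phi_{i_1}\phi_{i_2},\phi_j\rangle_\mu&\langle\phi_{i_1}\phi_{i_2},\mathbf 1\rangle_\mu\\ \langle\phi_i,\phi_{j_1}\phi_{j_2}\rangle_\mu&\langle\phi_i,\phi_j\rangle_\mu&\langle\phi_i,\mathbf 1\rangle_\mu\\ \langle\mathbf 1,\phi_{j_1}\phi_{j_2}\rangle_\mu&\langle\mathbf 1,\phi_j\rangle_\mu&\langle\mathbf 1,\mathbf 1\rangle_\mu\end{bmatrix},\qquad s_\ell^*=\begin{bmatrix}\langle\phi_{i_1}\phi_{i_2},\nabla\phi_\ell\cdot F\rangle_\mu\\ \langle\phi_i,\nabla\phi_\ell\cdot F\rangle_\mu\\ \langle\mathbf 1,\nabla\phi_\ell\cdot F\rangle_\mu\end{bmatrix}.$$ In the infinite data limit, QENDy can thus be viewed as $N$ continuous best approximations of $\nabla\phi_\ell\cdot F$, $\ell=1,\dots,N$, with respect to the $\mu$-weighted inner product, using the (linearly dependent) basis functions $$\{\phi_{i_1}\phi_{i_2}\}_{i_1,i_2=1}^N\cup\{\phi_i\}_{i=1}^N\cup\{\mathbf 1\},$$ called the quadratically augmented basis. QENDy itself (for finite $m$) is a discrete best approximation.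
   Context: Consider an autonomous ordinary differential equation $\dot x=F(x)$ with $F:\mathbb R^n\to\mathbb R^n$, and a feature map $\phi=(\phi_1,\dots,\phi_N)^\top:\mathbb R^n\to\mathbb R^N$, $N>n$, whose components (the basis functions) have gradients $\nabla\phi_i$. Write $\langle f,g\rangle_\mu=\int f(x)\,g(x)\,\mathrm d\mu(x)$ and $\mathbf 1(x)\equiv1$. Let $J(x)\in\mathbb R^{N\times n}$ have $i$th row $\nabla\phi_i(x)^\top$; given training data $(x^{(k)},\dot x^{(k)})$, $k=1,\dots,m$, set $z^{(k)}=\phi(x^{(k)})$, $\dot z^{(k)}=J(x^{(k)})\,\dot x^{(k)}$, $Z_1=[z^{(1)}\ \cdots\ z^{(m)}]$, $Z_2=[z^{(1)}\otimes z^{(1)}\ \cdots\ z^{(m)}\otimes z^{(m)}]$ (Kronecker products), $\dot Z=[\dot z^{(1)}\ \cdots\ \dot z^{(m)}]$, with $\dot Z_\ell$ the $\ell$th row of $\dot Z$, and let $\mathbf 1_m\in\mathbb R^m$ be the vector of ones. QENDy fits a quadratic model $\dot z=A(z\otimes z)+Bz+C$ by minimizing $\lVert\dot Z-AZ_2-BZ_1-C\mathbf 1_m^\top\rVert_F^2$ (Frobenius norm) over $A\in\mathbb R^{N\times N^2}$, $B\in\mathbb R^{N\times N}$, $C\in\mathbb R^N$. This leads to the linear systems $R\,v_\ell=s_\ell$, $\ell=1,\dots,N$, where $v_\ell=(A_\ell,B_\ell,C_\ell)^\top$ contains the $\ell$th rows of $A$, $B$ and the $\ell$th entry of $C$, and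 $$R=\begin{bmatrix}Z_2Z_2^\top&Z_2Z_1^\top&Z_2\mathbf 1_m\\ Z_1Z_2^\top&Z_1Z_1^\top&Z_1\mathbf 1_m\\ \mathbf 1_m^\top Z_2^\top&\mathbf 1_m^\top Z_1^\top&m\end{bmatrix},\qquad s_\ell=\begin{bmatrix}Z_2\dot Z_\ell^\top\\ Z_1\dot Z_\ell^\top\\ \mathbf 1_m^\top\dot Z_\ell^\top\end{bmatrix};$$ since $R$ need not be invertible, the minimum 2-norm solution $v_\ell=R^+s_\ell$ (pseudoinverse) is used. Best approximation: in a real Hilbert space, the best approximation of $f$ using (possibly linearly dependent) $\psi_1,\dots,\psi_p$ is the element $g=\sum_i\alpha_i\psi_i$ minimizing $\lVert f-g\rVert^2$; the coefficients solve $\sum_j\langle\psi_i,\psi_j\rangle\alpha_j=\langle\psi_i,f\rangle$, $i=1,\dots,p$. It is called continuous when the space consists of functions with the inner product $\langle\cdot,\cdot\rangle_\mu$, and discrete when the space is $\mathbb R^m$, the vectors consist of the values at the $m$ data points, and the inner product is a sum $\sum_k f_kg_k\mu_k$ with weights $\mu_k>0$. *)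

theory Defs
  imports "HOL-Probability.Probability" "Jordan_Normal_Form.Matrix"
begin

text \<open>From here on \<open>$\<close> is indexing of the (0-based, size-carrying) vectors of
  \<^theory>\<open>Jordan_Normal_Form.Matrix\<close>; the data sizes \<open>m\<close>, \<open>N\<close>, \<open>N\<^sup>2\<close> are natural numbers there.
  Only the state space is a vector type \<open>real ^ 'n\<close>.\<close>

unbundle no vec_syntax

section \<open>Linear algebra\<close>

definition grad :: "('a::real_inner \<Rightarrow> real) \<Rightarrow> 'a \<Rightarrow> 'a" where
  "grad f x = (THE D. GDERIV f x :> D)"

definition kron_vec :: "real vec \<Rightarrow> real vec \<Rightarrow> real vec" where
  "kron_vec u v = vec (dim_vec u * dim_vec v) (\<lambda>k. u $ (k div dim_vec v) * v $ (k mod dim_vec v))"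

definition ones_vec :: "nat \<Rightarrow> real vec" where
  "ones_vec m = vec m (\<lambda>_. 1)"

definition frob_norm :: "real mat \<Rightarrow> real" where
  "frob_norm P = sqrt (\<Sum>i<dim_row P. \<Sum>j<dim_col P. (P $$ (i, j))\<^sup>2)"

definition is_pinv :: "real mat \<Rightarrow> real mat \<Rightarrow> bool" where
  "is_pinv P Q \<longleftrightarrow> Q \<in> carrier_mat (dim_col P) (dim_row P)
     \<and> P * Q * P = P \<and> Q * P * Q = Q
     \<and> transpose_mat (P * Q) = P * Q \<and> transpose_mat (Q * P) = Q * P"

definition pinv :: "real mat \<Rightarrow> real mat" where
  "pinv P = (THE Q. is_pinv P Q)"

text \<open>The \<open>3 \<times> 3\<close> block matrix \<open>[P, Q, u; S, T, v; a\<^sup>T, b\<^sup>T, c]\<close> whose last block column and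
  block row have width and height 1.\<close>

definition block3 :: "real mat \<Rightarrow> real mat \<Rightarrow> real vec \<Rightarrow> real mat \<Rightarrow> real mat \<Rightarrow> real vec \<Rightarrow>
    real vec \<Rightarrow> real vec \<Rightarrow> real \<Rightarrow> real mat" where
  "block3 P Q u S T v a b c =
     four_block_mat
       (four_block_mat P Q S T)
       (mat_of_cols (dim_vec u + dim_vec v) [u @\<^sub>v v])
       (mat_of_rows (dim_vec a + dim_vec b) [a @\<^sub>v b])
       (mat 1 1 (\<lambda>_. c))"

definition block3_vec :: "real vec \<Rightarrow> real vec \<Rightarrow> real \<Rightarrow> real vec" where
  "block3_vec u v c = u @\<^sub>v v @\<^sub>v vec 1 (\<lambda>_. c)"

section \<open>Best approximation\<close>

definition lin_comb :: "nat \<Rightarrow> (nat \<Rightarrow> 'x \<Rightarrow> real) \<Rightarrow> real vec \<Rightarrow> 'x \<Rightarrow> real" where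
  "lin_comb p psi \<alpha> = (\<lambda>x. \<Sum>i<p. \<alpha> $ i * psi i x)"

text \<open>\<open>g\<close> is the best approximation of \<open>f\<close> using \<open>psi 0, \<dots>, psi (p - 1)\<close> in the space \<open>H\<close> of
  functions with inner product \<open>ip\<close>.\<close>

definition best_approx :: "('x \<Rightarrow> real) set \<Rightarrow> (('x \<Rightarrow> real) \<Rightarrow> ('x \<Rightarrow> real) \<Rightarrow> real) \<Rightarrow>
    nat \<Rightarrow> (nat \<Rightarrow> 'x \<Rightarrow> real) \<Rightarrow> ('x \<Rightarrow> real) \<Rightarrow> ('x \<Rightarrow> real) \<Rightarrow> bool" where
  "best_approx H ip p psi f g \<longleftrightarrow>
     f \<in> H \<and> (\<forall>i<p. psi i \<in> H) \<and>
     (\<exists>\<alpha>\<in>carrier_vec p. g = lin_comb p psi \<alpha>) \<and>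
     (\<forall>\<beta>\<in>carrier_vec p.
        ip (\<lambda>x. f x - g x) (\<lambda>x. f x - g x)
        \<le> ip (\<lambda>x. f x - lin_comb p psi \<beta> x) (\<lambda>x. f x - lin_comb p psi \<beta> x))"

text \<open>Continuous case. Elements of \<open>L\<^sup>2(\<mu>)\<close> are represented by functions, not by classes modulo
  null sets.\<close>

definition L2 :: "'x measure \<Rightarrow> ('x \<Rightarrow> real) set" where
  "L2 \<mu> = {f \<in> borel_measurable \<mu>. integrable \<mu> (\<lambda>x. (f x)\<^sup>2)}"

definition ip_L2 :: "'x measure \<Rightarrow> ('x \<Rightarrow> real) \<Rightarrow> ('x \<Rightarrow> real) \<Rightarrow> real" where
  "ip_L2 \<mu> f g = (\<integral>x. f x * g x \<partial>\<mu>)"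

text \<open>Discrete case: \<open>\<real>\<^sup>m\<close> as the functions on \<open>nat\<close> that vanish outside \<open>{..<m}\<close>, with the
  weighted inner product.\<close>

definition R_space :: "nat \<Rightarrow> (nat \<Rightarrow> real) set" where
  "R_space m = {f. \<forall>k\<ge>m. f k = 0}"

definition ip_discrete :: "nat \<Rightarrow> (nat \<Rightarrow> real) \<Rightarrow> (nat \<Rightarrow> real) \<Rightarrow> (nat \<Rightarrow> real) \<Rightarrow> real" where
  "ip_discrete m w f g = (\<Sum>k<m. f k * g k * w k)"

definition at_data :: "nat \<Rightarrow> (nat \<Rightarrow> 'x) \<Rightarrow> ('x \<Rightarrow> real) \<Rightarrow> nat \<Rightarrow> real" where
  "at_data m x f = (\<lambda>k. if k < m then f (x k) else 0)"

section \<open>QENDy\<close>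

text \<open>The 0-based form of \<open>N (j - 1) + i\<close>.\<close>

definition pair_idx :: "nat \<Rightarrow> nat \<Rightarrow> nat \<Rightarrow> nat" where
  "pair_idx N i j = N * j + i"

definition feat_prod :: "(nat \<Rightarrow> 'x \<Rightarrow> real) \<Rightarrow> nat \<Rightarrow> nat \<Rightarrow> 'x \<Rightarrow> real" where
  "feat_prod \<phi> i j = (\<lambda>x. \<phi> i x * \<phi> j x)"

definition grad_dot :: "('a::real_inner \<Rightarrow> 'a) \<Rightarrow> (nat \<Rightarrow> 'a \<Rightarrow> real) \<Rightarrow> nat \<Rightarrow> 'a \<Rightarrow> real" where
  "grad_dot F \<phi> l = (\<lambda>x. grad (\<phi> l) x \<bullet> F x)"

abbreviation aug_dim :: "nat \<Rightarrow> nat" where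
  "aug_dim N \<equiv> N\<^sup>2 + N + 1"

text \<open>The quadratically augmented basis as a family, in the order of the unknowns
  \<open>(A\<^sub>l, B\<^sub>l, C\<^sub>l)\<close>; position \<open>pair_idx N i j\<close> carries \<open>\<phi>\<^sub>i \<phi>\<^sub>j\<close>.\<close>

definition aug_basis :: "nat \<Rightarrow> (nat \<Rightarrow> 'x \<Rightarrow> real) \<Rightarrow> nat \<Rightarrow> 'x \<Rightarrow> real" where
  "aug_basis N \<phi> a =
     (if a < N\<^sup>2 then feat_prod \<phi> (a mod N) (a div N)
      else if a < N\<^sup>2 + N then \<phi> (a - N\<^sup>2)
      else (\<lambda>_. 1))"

text \<open>In the following, \<open>x\<close> and \<open>xd\<close> list the data points and the time derivatives, of which the
  first \<open>m\<close> are used.\<close>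

definition feat :: "nat \<Rightarrow> (nat \<Rightarrow> 'a \<Rightarrow> real) \<Rightarrow> 'a \<Rightarrow> real vec" where
  "feat N \<phi> x = vec N (\<lambda>i. \<phi> i x)"

text \<open>\<open>J(x) xd\<close>: the rows of \<open>J(x)\<close> are the transposed gradients.\<close>

definition feat_dot :: "nat \<Rightarrow> (nat \<Rightarrow> 'a::real_inner \<Rightarrow> real) \<Rightarrow> 'a \<Rightarrow> 'a \<Rightarrow> real vec" where
  "feat_dot N \<phi> x xd = vec N (\<lambda>i. grad (\<phi> i) x \<bullet> xd)"

definition Z1 :: "nat \<Rightarrow> (nat \<Rightarrow> 'a \<Rightarrow> real) \<Rightarrow> nat \<Rightarrow> (nat \<Rightarrow> 'a) \<Rightarrow> real mat" where
  "Z1 N \<phi> m x = mat_of_cols N (map (\<lambda>k. feat N \<phi> (x k)) [0..<m])"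

definition Z2 :: "nat \<Rightarrow> (nat \<Rightarrow> 'a \<Rightarrow> real) \<Rightarrow> nat \<Rightarrow> (nat \<Rightarrow> 'a) \<Rightarrow> real mat" where
  "Z2 N \<phi> m x =
     mat_of_cols (N\<^sup>2) (map (\<lambda>k. kron_vec (feat N \<phi> (x k)) (feat N \<phi> (x k))) [0..<m])"

definition Zdot :: "nat \<Rightarrow> (nat \<Rightarrow> 'a::real_inner \<Rightarrow> real) \<Rightarrow> nat \<Rightarrow> (nat \<Rightarrow> 'a) \<Rightarrow> (nat \<Rightarrow> 'a) \<Rightarrow>
    real mat" where
  "Zdot N \<phi> m x xd = mat_of_cols N (map (\<lambda>k. feat_dot N \<phi> (x k) (xd k)) [0..<m])"

definition is_qendy_fit :: "nat \<Rightarrow> (nat \<Rightarrow> 'a::real_inner \<Rightarrow> real) \<Rightarrow> nat \<Rightarrow> (nat \<Rightarrow> 'a) \<Rightarrow>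
    (nat \<Rightarrow> 'a) \<Rightarrow> real mat \<Rightarrow> real mat \<Rightarrow> real vec \<Rightarrow> bool" where
  "is_qendy_fit N \<phi> m x xd A B C \<longleftrightarrow>
     (let err = (\<lambda>A B C. (frob_norm (Zdot N \<phi> m x xd - A * Z2 N \<phi> m x - B * Z1 N \<phi> m x
                   - mat_of_cols N [C] * mat_of_rows m [ones_vec m]))\<^sup>2)
      in A \<in> carrier_mat N (N\<^sup>2) \<and> B \<in> carrier_mat N N \<and> C \<in> carrier_vec N \<and>
         (\<forall>A'\<in>carrier_mat N (N\<^sup>2). \<forall>B'\<in>carrier_mat N N. \<forall>C'\<in>carrier_vec N.
            err A B C \<le> err A' B' C'))"

definition qendy_R :: "nat \<Rightarrow> (nat \<Rightarrow> 'a \<Rightarrow> real) \<Rightarrow> nat \<Rightarrow> (nat \<Rightarrow> 'a) \<Rightarrow> real mat" where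
  "qendy_R N \<phi> m x =
     (let P = Z2 N \<phi> m x; Q = Z1 N \<phi> m x; e = ones_vec m in
      block3
        (P * transpose_mat P) (P * transpose_mat Q) (P *\<^sub>v e)
        (Q * transpose_mat P) (Q * transpose_mat Q) (Q *\<^sub>v e)
        (P *\<^sub>v e)             (Q *\<^sub>v e)             (real m))"

definition qendy_s :: "nat \<Rightarrow> (nat \<Rightarrow> 'a::real_inner \<Rightarrow> real) \<Rightarrow> nat \<Rightarrow> (nat \<Rightarrow> 'a) \<Rightarrow> (nat \<Rightarrow> 'a) \<Rightarrow>
    nat \<Rightarrow> real vec" where
  "qendy_s N \<phi> m x xd l =
     (let d = row (Zdot N \<phi> m x xd) l in
      block3_vec (Z2 N \<phi> m x *\<^sub>v d) (Z1 N \<phi> m x *\<^sub>v d) (ones_vec m \<bullet> d))"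

definition qendy_v :: "nat \<Rightarrow> (nat \<Rightarrow> 'a::real_inner \<Rightarrow> real) \<Rightarrow> nat \<Rightarrow> (nat \<Rightarrow> 'a) \<Rightarrow> (nat \<Rightarrow> 'a) \<Rightarrow>
    nat \<Rightarrow> real vec" where
  "qendy_v N \<phi> m x xd l = pinv (qendy_R N \<phi> m x) *\<^sub>v qendy_s N \<phi> m x xd l"

definition limit_R :: "'x measure \<Rightarrow> nat \<Rightarrow> (nat \<Rightarrow> 'x \<Rightarrow> real) \<Rightarrow> real mat" where
  "limit_R \<mu> N \<phi> =
     (let q = (\<lambda>a. feat_prod \<phi> (a mod N) (a div N)); one = (\<lambda>_. 1); ip = ip_L2 \<mu> in
      block3
        (mat (N\<^sup>2) (N\<^sup>2) (\<lambda>(a, b). ip (q a) (q b)))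
        (mat (N\<^sup>2) N (\<lambda>(a, j). ip (q a) (\<phi> j)))
        (vec (N\<^sup>2) (\<lambda>a. ip (q a) one))
        (mat N (N\<^sup>2) (\<lambda>(i, b). ip (\<phi> i) (q b)))
        (mat N N (\<lambda>(i, j). ip (\<phi> i) (\<phi> j)))
        (vec N (\<lambda>i. ip (\<phi> i) one))
        (vec (N\<^sup>2) (\<lambda>b. ip one (q b)))
        (vec N (\<lambda>j. ip one (\<phi> j)))
        (ip one one))"

definition limit_s :: "('a::real_inner) measure \<Rightarrow> nat \<Rightarrow> (nat \<Rightarrow> 'a \<Rightarrow> real) \<Rightarrow> ('a \<Rightarrow> 'a) \<Rightarrow> nat \<Rightarrow>
    real vec" where
  "limit_s \<mu> N \<phi> F l =
     (let q = (\<lambda>a. feat_prod \<phi> (a mod N) (a div N)); ip = ip_L2 \<mu>; h = grad_dot F \<phi> l in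
      block3_vec
        (vec (N\<^sup>2) (\<lambda>a. ip (q a) h))
        (vec N (\<lambda>i. ip (\<phi> i) h))
        (ip (\<lambda>_. 1) h))"

end

theory Submission
  imports Defs
begin

text \<open>The entries of the scaled systems are sample averages of products of two functions from
  \<open>L\<^sup>2(\<mu>)\<close>, which are integrable, so the strong law of large numbers under a bare first-moment
  hypothesis yields the limits. Both \<open>R\<close> and \<open>R\<^sup>*\<close> are Gram matrices of the augmented basis,
  up to a factor for weighted discrete inner products, so their linear systems are normal
  equations. These are always solvable, by Gram-Schmidt without assuming independence, and hence
  solved by the pseudoinverse. The squared Frobenius norm splits into one independent least
  squares problem for each row.\<close>

section \<open>The strong law of large numbers\<close>

text \<open>A product of two L2 functions is integrable but need not have a second moment, so
  variance estimates cannot give the almost sure limits. The strong law is therefore proved by a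
  maximal argument of ergodic type, in which independence enters through the shift invariance of the
  joint law and through the 0-1 law. The other obstacle is degeneracy. The augmented basis is
  linearly dependent, so \<open>R\<close> and its limit are singular, and functions vanishing almost
  everywhere have norm zero. Nothing may be inverted and the norm may not be treated as definite;
  instead, a null vector is shown to be orthogonal to everything. \<open>pinv\<close> is defined by
  \<open>THE\<close>, so it says nothing until existence and uniqueness are shown; for symmetric
  matrices existence is drawn from the solvability of normal equations and not from a spectral
  decomposition. Taking pseudoinverses is not a continuous operation, so the limits are those of the
  entries, and the limit system is solved in its own right.\<close>

text \<open>The maximum of the partial sums of lengths \<open>0, \<dots>, n\<close>. Splitting off the first summand
  expresses it through the shifted sequence, which has the same law when the summands are
  i.i.d.\<close>

fun run_max :: "nat \<Rightarrow> (nat \<Rightarrow> real) \<Rightarrow> real" where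
  "run_max 0 y = 0"
| "run_max (Suc n) y = max 0 (y 0 + run_max n (\<lambda>i. y (Suc i)))"

lemma run_max_nonneg: "0 \<le> run_max n y"
  by (cases n) auto

lemma run_max_mono: "m \<le> n \<Longrightarrow> run_max m y \<le> run_max n y"
proof (induction m arbitrary: n y)
  case 0
  then show ?case by (simp add: run_max_nonneg)
next
  case (Suc m)
  then obtain n' where n': "n = Suc n'" "m \<le> n'" by (cases n) auto
  have "run_max m (\<lambda>i. y (Suc i)) \<le> run_max n' (\<lambda>i. y (Suc i))"
    using Suc.IH n' by blast
  with n' show ?case by auto
qed

lemma sum_le_run_max: "(\<Sum>i<n. y i) \<le> run_max n y"
proof (induction n arbitrary: y)
  case (Suc n)
  have "(\<Sum>i<Suc n. y i) = y 0 + (\<Sum>i<n. y (Suc i))" by (rule sum.lessThan_Suc_shift)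
  also have "\<dots> \<le> y 0 + run_max n (\<lambda>i. y (Suc i))" using Suc.IH by simp
  finally show ?case by simp
qed simp

text \<open>Dropping the first term changes the running maximum by an amount controlled by that term
  alone. Boundedness thus ignores any finite initial segment, which is what makes it a tail
  event.\<close>

lemma bdd_run_max_shift:
  "bdd_above (range (\<lambda>n. run_max n (\<lambda>i. y (i + k)))) \<longleftrightarrow> bdd_above (range (\<lambda>n. run_max n y))"
proof (induction k)
  case (Suc k)
  have step: "bdd_above (range (\<lambda>n. run_max n (\<lambda>i. z (Suc i)))) \<longleftrightarrow> bdd_above (range (\<lambda>n. run_max n z))"
    for z
  proof
    assume "bdd_above (range (\<lambda>n. run_max n (\<lambda>i. z (Suc i))))"
    then obtain b where b: "run_max n (\<lambda>i. z (Suc i)) \<le> b" for n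
      by (auto simp: bdd_above_def)
    have "run_max n z \<le> max 0 (z 0 + b)" for n
      using b[of "n - 1"] by (cases n) auto
    then show "bdd_above (range (\<lambda>n. run_max n z))" by (auto intro!: bdd_aboveI)
  next
    assume "bdd_above (range (\<lambda>n. run_max n z))"
    then obtain b where b: "run_max n z \<le> b" for n
      by (auto simp: bdd_above_def)
    have "run_max n (\<lambda>i. z (Suc i)) \<le> b - z 0" for n
      using b[of "Suc n"] by auto
    then show "bdd_above (range (\<lambda>n. run_max n (\<lambda>i. z (Suc i))))" by (auto intro!: bdd_aboveI)
  qed
  show ?case using step[of "\<lambda>i. y (i + k)"] Suc by simp
qed simp

lemma measurable_run_max:
  assumes "\<And>i. Y i \<in> borel_measurable M"
  shows "(\<lambda>\<omega>. run_max n (\<lambda>i. Y i \<omega>)) \<in> borel_measurable M"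
  using assms
proof (induction n arbitrary: Y)
  case (Suc n)
  note [measurable] = Suc.prems Suc.IH[of "\<lambda>i. Y (Suc i)", OF Suc.prems]
  show ?case by simp
qed simp

lemma integrable_run_max:
  fixes Y :: "nat \<Rightarrow> 'w \<Rightarrow> real"
  assumes "\<And>i. integrable M (Y i)"
  shows "integrable M (\<lambda>\<omega>. run_max n (\<lambda>i. Y i \<omega>))"
  using assms
proof (induction n arbitrary: Y)
  case (Suc n)
  have "integrable M (\<lambda>\<omega>. run_max n (\<lambda>i. Y (Suc i) \<omega>))"
    using Suc.IH[of "\<lambda>i. Y (Suc i)"] Suc.prems by blast
  then show ?case using Suc.prems[of 0] by simp
qed simp

context prob_space
begin

lemma iid_integrable:
  fixes Y :: "nat \<Rightarrow> 'a \<Rightarrow> real"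
  assumes "\<And>k. random_variable borel (Y k)"
    and "\<And>k. distr M borel (Y k) = distr M borel (Y 0)"
    and "integrable M (Y 0)"
  shows "integrable M (Y k)"
proof -
  have "integrable (distr M borel (Y k)) (\<lambda>x. x)"
    unfolding assms(2)[of k] using assms(1,3) by (subst integrable_distr_eq) auto
  then show ?thesis using assms(1) by (subst (asm) integrable_distr_eq) auto
qed

text \<open>The joint law of an i.i.d. sequence is the product of copies of the common law
  \<open>D\<close>, and reindexing such a product along the injective map \<open>Suc\<close>
  reproduces it. Equal marginals alone would not do, because \<open>run_max\<close> depends on many
  coordinates at once.\<close>

lemma expectation_run_max_shift:
  fixes Y :: "nat \<Rightarrow> 'a \<Rightarrow> real"
  assumes indep: "indep_vars (\<lambda>_. borel) Y UNIV"
    and ident: "\<And>k. distr M borel (Y k) = distr M borel (Y 0)"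
  shows "expectation (\<lambda>\<omega>. run_max n (\<lambda>i. Y (Suc i) \<omega>)) = expectation (\<lambda>\<omega>. run_max n (\<lambda>i. Y i \<omega>))"
proof -
  have rv[measurable]: "random_variable borel (Y k)" for k
    using indep by (auto simp: indep_vars_def)
  define D where "D = distr M borel (Y 0)"
  \<comment> \<open>The shift map. Restriction to \<open>UNIV\<close> is the identity and only gives
    \<open>S\<close> the form used by \<open>distr_PiM_reindex\<close>.\<close>
  define S where "S = (\<lambda>y::nat \<Rightarrow> real. \<lambda>i\<in>UNIV. y (Suc i))"
  let ?B = "PiM UNIV (\<lambda>_::nat. borel :: real measure)"
  let ?P = "PiM UNIV (\<lambda>_::nat. D)"
  have sets_P: "sets ?P = sets ?B"
    by (intro sets_PiM_cong refl) (simp add: D_def)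
  interpret D: prob_space D unfolding D_def by (rule prob_space_distr) (rule rv)
  have idD: "distr M borel (Y k) = D" for k using ident D_def by metis
  have dist: "distr M ?B (\<lambda>x. \<lambda>i\<in>UNIV. Y i x) = ?P"
    using indep indep_vars_iff_distr_eq_PiM[where I = UNIV and M' = "\<lambda>_. borel" and X = Y] rv
    by (simp add: idD)
  have shift: "distr ?P ?P S = ?P"
    unfolding S_def using distr_PiM_reindex[of UNIV "\<lambda>_. D" Suc UNIV] D.prob_space_axioms by simp
  have run[measurable]: "run_max n \<in> borel_measurable ?B"
    using measurable_run_max[of "\<lambda>i y. y i" ?B n] by simp
  have S[measurable]: "S \<in> measurable ?B ?B"
    unfolding S_def by (intro measurable_restrict) simp
  have Ym[measurable]: "(\<lambda>x. \<lambda>i\<in>UNIV. Y i x) \<in> measurable M ?B"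
    by (intro measurable_restrict rv)
  have "expectation (\<lambda>\<omega>. run_max n (\<lambda>i. Y (Suc i) \<omega>)) = expectation (\<lambda>\<omega>. run_max n (S (\<lambda>i\<in>UNIV. Y i \<omega>)))"
    by (simp add: S_def restrict_def)
  also have "\<dots> = integral\<^sup>L (distr M ?B (\<lambda>x. \<lambda>i\<in>UNIV. Y i x)) (\<lambda>y. run_max n (S y))"
    by (rule integral_distr[symmetric]) measurable
  also have "\<dots> = integral\<^sup>L ?P (\<lambda>y. run_max n (S y))"
    unfolding dist ..
  also have "\<dots> = integral\<^sup>L (distr ?P ?P S) (run_max n)"
  proof (rule integral_distr[symmetric])
    show "S \<in> measurable ?P ?P"
      using S unfolding measurable_cong_sets[OF sets_P sets_P] .
    show "run_max n \<in> borel_measurable ?P"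
      using run unfolding measurable_cong_sets[OF sets_P refl] .
  qed
  also have "\<dots> = integral\<^sup>L (distr M ?B (\<lambda>x. \<lambda>i\<in>UNIV. Y i x)) (run_max n)"
    unfolding shift dist ..
  also have "\<dots> = expectation (\<lambda>\<omega>. run_max n (\<lambda>i\<in>UNIV. Y i \<omega>))"
    by (rule integral_distr) measurable
  finally show ?thesis by (simp add: restrict_def)
qed

lemma bdd_run_max_0_1:
  fixes Y :: "nat \<Rightarrow> 'a \<Rightarrow> real"
  assumes indep: "indep_vars (\<lambda>_. borel) Y UNIV"
  defines "E \<equiv> {\<omega> \<in> space M. bdd_above (range (\<lambda>n. run_max n (\<lambda>i. Y i \<omega>)))}"
  shows "E \<in> events \<and> (prob E = 0 \<or> prob E = 1)"
proof -
  define G where "G = (\<lambda>i. {Y i -` B \<inter> space M |B. B \<in> sets (borel :: real measure)})"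
  have rv: "random_variable borel (Y k)" for k
    using indep by (auto simp: indep_vars_def)
  have sub: "G i \<subseteq> events" for i using rv by (auto simp: G_def)
  have tail: "E \<in> tail_events G"
    unfolding tail_events_def
  proof
    fix k
    let ?S = "sigma (space M) (\<Union>(G ` {k..}))"
    have G: "\<Union>(G ` {k..}) \<subseteq> Pow (space M)" by (auto simp: G_def)
    have Ym: "Y (i + k) \<in> borel_measurable ?S" for i
    proof (rule measurableI)
      fix B :: "real set" assume "B \<in> sets borel"
      then have "Y (i + k) -` B \<inter> space M \<in> \<Union>(G ` {k..})"
        by (auto simp: G_def intro!: bexI[of _ "i + k"])
      then show "Y (i + k) -` B \<inter> space ?S \<in> sets ?S" using G by auto
    qed auto
    have [measurable]: "(\<lambda>\<omega>. run_max n (\<lambda>i. Y (i + k) \<omega>)) \<in> borel_measurable ?S" for n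
      by (rule measurable_run_max) (rule Ym)
    \<comment> \<open>For every \<open>k\<close> the event is rewritten in terms of the variables
      from index \<open>k\<close> on. The bound ranges over naturals, so that the quantifiers are
      countable and measurability is automatic.\<close>
    have "E = {\<omega> \<in> space ?S. \<exists>b::nat. \<forall>n. run_max n (\<lambda>i. Y (i + k) \<omega>) \<le> real b}"
    proof -
      have "bdd_above (range u) \<longleftrightarrow> (\<exists>b::nat. \<forall>n. u n \<le> real b)" for u :: "nat \<Rightarrow> real"
      proof
        assume "bdd_above (range u)"
        then obtain b where b: "u n \<le> b" for n by (auto simp: bdd_above_def)
        obtain c where "b \<le> real c" using real_arch_simple by blast
        then show "\<exists>b::nat. \<forall>n. u n \<le> real b" using b order_trans by blast
      qed (auto simp: bdd_above_def)
      then show ?thesis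
        unfolding E_def bdd_run_max_shift[of "\<lambda>i. Y i _" k, symmetric] space_measure_of[OF G] by simp
    qed
    also have "\<dots> \<in> sets ?S" by measurable
    finally show "E \<in> sigma_sets (space M) (\<Union>(G ` {k..}))" using G by simp
  qed
  \<comment> \<open>The preimages of all Borel sets already form a sigma-algebra, as the 0-1 law
    requires of each member of the family.\<close>
  have sa: "sigma_algebra (space M) (G i)" for i
    using sets.sigma_algebra_axioms[of "vimage_algebra (space M) (Y i) borel"]
      sets_vimage_algebra2[of "Y i" "space M" "borel :: real measure"]
    by (simp add: G_def)
  have "indep_sets G UNIV" using indep by (simp add: indep_vars_def2 G_def)
  from kolmogorov_0_1_law[OF sa this tail] tail_events_sets[of G, OF sub] tail show ?thesis by auto
qed

text \<open>With \<open>W\<^sub>n\<close> the running maximum and \<open>W'\<^sub>n\<close> that of the shifted sequence,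
  \<open>W\<^sub>n\<^sub>+\<^sub>1 - W'\<^sub>n = max (- W'\<^sub>n) Y\<^sub>0\<close> has nonnegative mean, since \<open>W\<^sub>n\<close> and \<open>W'\<^sub>n\<close> have equal means.
  If the sums were unbounded with positive probability, then almost surely by the 0-1 law, and
  the means would tend to the mean of \<open>Y\<^sub>0\<close> by dominated convergence, which is negative.\<close>

lemma iid_neg_mean_sums_bounded:
  fixes Y :: "nat \<Rightarrow> 'a \<Rightarrow> real"
  assumes indep: "indep_vars (\<lambda>_. borel) Y UNIV"
    and ident: "\<And>k. distr M borel (Y k) = distr M borel (Y 0)"
    and int: "integrable M (Y 0)"
    and neg: "expectation (Y 0) < 0"
  shows "AE \<omega> in M. bdd_above (range (\<lambda>n. \<Sum>i<n. Y i \<omega>))"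
proof -
  have rv[measurable]: "random_variable borel (Y k)" for k
    using indep by (auto simp: indep_vars_def)
  have intY: "integrable M (Y k)" for k using iid_integrable[of Y k, OF rv ident int] .
  define W where "W = (\<lambda>n \<omega>. run_max n (\<lambda>i. Y i \<omega>))"
  define W' where "W' = (\<lambda>n \<omega>. run_max n (\<lambda>i. Y (Suc i) \<omega>))"
  have intW: "integrable M (W n)" "integrable M (W' n)" for n
    unfolding W_def W'_def by (intro integrable_run_max intY)+
  have Wm[measurable]: "W n \<in> borel_measurable M" "W' n \<in> borel_measurable M" for n
    using intW by auto
  define E where "E = {\<omega> \<in> space M. bdd_above (range (\<lambda>n. W n \<omega>))}"
  have E: "E \<in> events" "prob E = 0 \<or> prob E = 1"
    using bdd_run_max_0_1[OF indep] by (auto simp: E_def W_def)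
  have "prob E \<noteq> 0"
  proof
    assume "prob E = 0"
    then have AE: "AE \<omega> in M. \<not> bdd_above (range (\<lambda>n. W n \<omega>))"
      using E(1) AE_iff_measurable[of E M "\<lambda>\<omega>. \<not> bdd_above (range (\<lambda>n. W n \<omega>))"]
      by (simp add: E_def emeasure_eq_measure)
    define D where "D = (\<lambda>n \<omega>. max (- W' n \<omega>) (Y 0 \<omega>))"
    have D: "D n \<omega> = W (Suc n) \<omega> - W' n \<omega>" for n \<omega>
      by (simp add: D_def W_def W'_def)
    have "expectation (D n) \<ge> 0" for n
    proof -
      have "expectation (W n) \<le> expectation (W (Suc n))"
        by (rule integral_mono[OF intW(1) intW(1)]) (unfold W_def, rule run_max_mono, simp)
      moreover have "expectation (W' n) = expectation (W n)"
        unfolding W_def W'_def by (rule expectation_run_max_shift[OF indep ident])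
      ultimately show ?thesis
        unfolding D using intW by simp
    qed
    \<comment> \<open>Since \<open>W' n\<close> is nonnegative, \<open>D n\<close> equals
      \<open>Y 0\<close> where \<open>Y 0\<close> is nonnegative and lies between \<open>Y 0\<close>
      and 0 elsewhere; hence the dominating function. Pointwise, \<open>D n\<close> is eventually
      equal to \<open>Y 0\<close>: once \<open>W'\<close> exceeds \<open>- Y 0\<close> it stays
      above, by monotonicity in \<open>n\<close>.\<close>
    moreover have "(\<lambda>n. expectation (D n)) \<longlonglongrightarrow> expectation (Y 0)"
    proof (rule integral_dominated_convergence[where w = "\<lambda>\<omega>. \<bar>Y 0 \<omega>\<bar>"])
      show "AE \<omega> in M. (\<lambda>n. D n \<omega>) \<longlonglongrightarrow> Y 0 \<omega>"
        using AE
      proof eventually_elim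
        case (elim \<omega>)
        then have "\<not> bdd_above (range (\<lambda>n. W' n \<omega>))"
          using bdd_run_max_shift[of "\<lambda>i. Y i \<omega>" 1] by (simp add: W_def W'_def)
        then obtain n0 where n0: "W' n0 \<omega> > - Y 0 \<omega>"
          by (auto simp: bdd_above_def not_le)
        have "D n \<omega> = Y 0 \<omega>" if "n0 \<le> n" for n
          using n0 run_max_mono[OF that, of "\<lambda>i. Y (Suc i) \<omega>"] by (auto simp: D_def W'_def)
        then show ?case
          by (intro tendsto_eventually) (auto simp: eventually_sequentially)
      qed
      show "AE \<omega> in M. norm (D n \<omega>) \<le> \<bar>Y 0 \<omega>\<bar>" for n
      proof (intro AE_I2)
        fix \<omega>
        show "norm (D n \<omega>) \<le> \<bar>Y 0 \<omega>\<bar>"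
          using run_max_nonneg[of n "\<lambda>i. Y (Suc i) \<omega>"] by (auto simp: D_def W'_def)
      qed
    qed (use int in \<open>auto simp: D_def\<close>)
    ultimately have "expectation (Y 0) \<ge> 0" using LIMSEQ_le_const by blast
    with neg show False by simp
  qed
  with E have "AE \<omega> in M. \<omega> \<in> E" by (simp add: prob_eq_1)
  then show ?thesis
  proof eventually_elim
    case (elim \<omega>)
    then obtain b where "W n \<omega> \<le> b" for n by (auto simp: E_def bdd_above_def)
    then have "(\<Sum>i<n. Y i \<omega>) \<le> b" for n
      using sum_le_run_max[of "\<lambda>i. Y i \<omega>" n] order_trans unfolding W_def by blast
    then show ?case by (auto intro!: bdd_aboveI)
  qed
qed

text \<open>Subtracting a constant \<open>c\<close> slightly above the mean leaves a sequence of
  negative mean, whose partial sums are bounded by some \<open>b\<close> depending on the outcome;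
  the average is then at most \<open>c + b / m\<close>. One of the two terms
  \<open>1 / real (Suc j)\<close> is the gap between \<open>c\<close> and the mean, the other
  absorbs \<open>b / m\<close>. Margins indexed by naturals need only countably many null
  sets.\<close>

lemma iid_average_upper:
  fixes Y :: "nat \<Rightarrow> 'a \<Rightarrow> real"
  assumes indep: "indep_vars (\<lambda>_. borel) Y UNIV"
    and ident: "\<And>k. distr M borel (Y k) = distr M borel (Y 0)"
    and int: "integrable M (Y 0)"
  shows "AE \<omega> in M. \<forall>j. \<forall>\<^sub>F m in sequentially.
    (\<Sum>k<m. Y k \<omega>) / real m < expectation (Y 0) + 2 / real (Suc j)"
proof (subst AE_all_countable, intro allI)
  fix j :: nat
  define c where "c = expectation (Y 0) + 1 / real (Suc j)"
  have rv[measurable]: "random_variable borel (Y k)" for k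
    using indep by (auto simp: indep_vars_def)
  have "AE \<omega> in M. bdd_above (range (\<lambda>n. \<Sum>i<n. Y i \<omega> - c))"
  proof (rule iid_neg_mean_sums_bounded)
    show "indep_vars (\<lambda>_. borel) (\<lambda>k \<omega>. Y k \<omega> - c) UNIV"
      by (rule indep_vars_compose2[OF indep]) simp
    have "distr M borel (\<lambda>\<omega>. Y k \<omega> - c) = distr (distr M borel (Y k)) borel (\<lambda>x. x - c)" for k
      by (subst distr_distr) (auto simp: comp_def)
    then show "distr M borel (\<lambda>\<omega>. Y k \<omega> - c) = distr M borel (\<lambda>\<omega>. Y 0 \<omega> - c)" for k
      using ident by metis
    show "expectation (\<lambda>\<omega>. Y 0 \<omega> - c) < 0"
      using int by (simp add: c_def prob_space)
  qed (use int in simp)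
  then show "AE \<omega> in M. \<forall>\<^sub>F m in sequentially.
    (\<Sum>k<m. Y k \<omega>) / real m < expectation (Y 0) + 2 / real (Suc j)"
  proof eventually_elim
    case (elim \<omega>)
    then obtain b where b: "(\<Sum>i<n. Y i \<omega> - c) \<le> b" for n by (auto simp: bdd_above_def)
    have "(\<lambda>m. b / real m) \<longlonglongrightarrow> 0" by (rule lim_const_over_n)
    then have "\<forall>\<^sub>F m in sequentially. b / real m < 1 / real (Suc j)"
      by (rule order_tendstoD) simp
    then show ?case using eventually_gt_at_top[of 0]
    proof eventually_elim
      case (elim m)
      have "(\<Sum>k<m. Y k \<omega>) \<le> b + real m * c"
        using b[of m] by (simp add: sum_subtractf)
      then have "(\<Sum>k<m. Y k \<omega>) / real m \<le> (b + real m * c) / real m"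
        by (rule divide_right_mono) simp
      also have "\<dots> = b / real m + c" using elim by (simp add: field_simps)
      also have "\<dots> < expectation (Y 0) + 2 / real (Suc j)"
        using elim by (simp add: c_def)
      finally show ?case .
    qed
  qed
qed

text \<open>The one-sided bound, applied to \<open>Y\<close> and to \<open>- Y\<close>, encloses the
  averages.\<close>

theorem strong_law_of_large_numbers:
  fixes Y :: "nat \<Rightarrow> 'a \<Rightarrow> real"
  assumes indep: "indep_vars (\<lambda>_. borel) Y UNIV"
    and ident: "\<And>k. distr M borel (Y k) = distr M borel (Y 0)"
    and int: "integrable M (Y 0)"
  shows "AE \<omega> in M. (\<lambda>m. (\<Sum>k<m. Y k \<omega>) / real m) \<longlonglongrightarrow> expectation (Y 0)"
proof -
  have rv[measurable]: "random_variable borel (Y k)" for k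
    using indep by (auto simp: indep_vars_def)
  have indep': "indep_vars (\<lambda>_. borel) (\<lambda>k \<omega>. - Y k \<omega>) UNIV"
    by (rule indep_vars_compose2[OF indep]) simp
  have "distr M borel (\<lambda>\<omega>. - Y k \<omega>) = distr (distr M borel (Y k)) borel uminus" for k
    by (subst distr_distr) (auto simp: comp_def)
  then have ident': "distr M borel (\<lambda>\<omega>. - Y k \<omega>) = distr M borel (\<lambda>\<omega>. - Y 0 \<omega>)" for k
    using ident by metis
  have "AE \<omega> in M. \<forall>j. \<forall>\<^sub>F m in sequentially.
      (\<Sum>k<m. - Y k \<omega>) / real m < expectation (\<lambda>\<omega>. - Y 0 \<omega>) + 2 / real (Suc j)"
    by (rule iid_average_upper[where Y = "\<lambda>k \<omega>. - Y k \<omega>", OF indep' ident']) (use int in simp)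
  with iid_average_upper[OF assms] show ?thesis
  proof eventually_elim
    case (elim \<omega>)
    have small: "\<exists>j. 2 / real (Suc j) < e" if "e > 0" for e :: real
      using reals_Archimedean[of "e / 2"] that by (auto simp: field_simps)
    show ?case
    proof (rule tendstoI)
      fix e :: real assume "e > 0"
      then obtain j where j: "2 / real (Suc j) < e" using small by blast
      show "\<forall>\<^sub>F m in sequentially. dist ((\<Sum>k<m. Y k \<omega>) / real m) (expectation (Y 0)) < e"
        using elim(1)[rule_format, of j] elim(2)[rule_format, of j]
        by eventually_elim (use j in \<open>auto simp: dist_real_def sum_negf\<close>)
    qed
  qed
qed

end

text \<open>The strong law for the real sequence \<open>f (X k)\<close>. Integrability under \<mu>
  is all that is asked of \<open>f\<close>, so products of two L2 functions qualify.\<close>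

lemma (in prob_space) sample_average_tendsto:
  fixes X :: "nat \<Rightarrow> 'a \<Rightarrow> 'b::topological_space"
  assumes indep: "indep_vars (\<lambda>_. borel) X UNIV"
    and distr: "\<And>k. distr M borel (X k) = \<mu>"
    and f: "integrable \<mu> f"
  shows "AE \<omega> in M. (\<lambda>m. (\<Sum>k<m. f (X k \<omega>)) / real m) \<longlonglongrightarrow> (\<integral>x. f x \<partial>\<mu> :: real)"
proof -
  have rv[measurable]: "random_variable borel (X k)" for k
    using indep by (auto simp: indep_vars_def)
  have sets_\<mu>: "sets \<mu> = sets borel" using distr[of 0] by (metis sets_distr)
  have f_borel[measurable]: "f \<in> borel_measurable borel"
    using borel_measurable_integrable[OF f] unfolding measurable_cong_sets[OF sets_\<mu> refl] .
  have "distr M borel (\<lambda>\<omega>. f (X k \<omega>)) = distr \<mu> borel f" for k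
    unfolding distr[of k, symmetric] by (subst distr_distr) (auto simp: comp_def)
  then have id: "distr M borel (\<lambda>\<omega>. f (X k \<omega>)) = distr M borel (\<lambda>\<omega>. f (X 0 \<omega>))" for k
    by metis
  have "expectation (\<lambda>\<omega>. f (X 0 \<omega>)) = (\<integral>x. f x \<partial>\<mu>)"
    unfolding distr[of 0, symmetric] by (rule integral_distr[symmetric]) measurable
  moreover have "integrable M (\<lambda>\<omega>. f (X 0 \<omega>))"
    using f unfolding distr[of 0, symmetric] by (subst (asm) integrable_distr_eq) auto
  ultimately show ?thesis
    using strong_law_of_large_numbers[where Y = "\<lambda>k \<omega>. f (X k \<omega>)",
        OF indep_vars_compose2[OF indep f_borel] id] by simp
qed

section \<open>Best approximation and the normal equations\<close>

text \<open>The first-order condition at a minimum, without differentiation. It serves both the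
  orthogonality of a minimal residual and the degenerate case of Cauchy-Schwarz.\<close>

lemma linear_form_zero_if_quadratic_nonneg:
  fixes a b :: real
  assumes "0 \<le> a" and "\<And>t. 0 \<le> t\<^sup>2 * a - 2 * t * b"
  shows "b = 0"
proof (rule ccontr)
  assume "b \<noteq> 0"
  \<comment> \<open>The quadratic is minimal at \<open>t = b / a\<close>; adding 1 to the
    denominator avoids the case \<open>a = 0\<close> and still gives a negative value.\<close>
  define c where "c = a + 1"
  have c: "a = c - 1" "c \<noteq> 0" using assms(1) by (auto simp: c_def)
  have "0 \<le> (b / c)\<^sup>2 * a - 2 * (b / c) * b" by (rule assms(2))
  also have "\<dots> = - (b\<^sup>2 * (a + 2)) / c\<^sup>2"
    unfolding c(1) using c(2) by (simp add: field_simps power2_eq_square)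
  also have "\<dots> < 0"
    using \<open>b \<noteq> 0\<close> assms(1) c(2) by (intro divide_neg_pos) auto
  finally show False by simp
qed

text \<open>There is no definiteness, because L2 consists of functions and not of classes. The laws
  are restricted to \<open>H\<close>, since outside it the integral defining \<open>ip_L2\<close>
  need not behave linearly. The same interface serves L2, the sampled space and, through the columns
  of a matrix, the pseudoinverse.\<close>

locale semi_inner_function_space =
  fixes H :: "('x \<Rightarrow> real) set" and ip :: "('x \<Rightarrow> real) \<Rightarrow> ('x \<Rightarrow> real) \<Rightarrow> real"
  assumes zero_mem: "(\<lambda>_. 0) \<in> H"
    and add_mem: "f \<in> H \<Longrightarrow> g \<in> H \<Longrightarrow> (\<lambda>x. f x + g x) \<in> H"
    and scale_mem: "f \<in> H \<Longrightarrow> (\<lambda>x. c * f x) \<in> H"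
    and ip_commute: "f \<in> H \<Longrightarrow> g \<in> H \<Longrightarrow> ip f g = ip g f"
    and ip_add_left: "f \<in> H \<Longrightarrow> g \<in> H \<Longrightarrow> h \<in> H \<Longrightarrow> ip (\<lambda>x. f x + g x) h = ip f h + ip g h"
    and ip_scale_left: "f \<in> H \<Longrightarrow> h \<in> H \<Longrightarrow> ip (\<lambda>x. c * f x) h = c * ip f h"
    and ip_nonneg: "f \<in> H \<Longrightarrow> 0 \<le> ip f f"
begin

lemma diff_mem: "f \<in> H \<Longrightarrow> g \<in> H \<Longrightarrow> (\<lambda>x. f x - g x) \<in> H"
  using add_mem[of f "\<lambda>x. - 1 * g x"] scale_mem[of g "- 1"] by simp

lemma ip_diff_left:
  "f \<in> H \<Longrightarrow> g \<in> H \<Longrightarrow> h \<in> H \<Longrightarrow> ip (\<lambda>x. f x - g x) h = ip f h - ip g h"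
  using ip_add_left[of f "\<lambda>x. - 1 * g x" h] scale_mem[of g "- 1"] ip_scale_left[of g h "- 1"] by simp

lemma ip_zero_left: "h \<in> H \<Longrightarrow> ip (\<lambda>_. 0) h = 0"
  using ip_scale_left[of "\<lambda>_. 0" h 0] zero_mem by simp

lemma ip_add_scaled_square:
  assumes "f \<in> H" "g \<in> H"
  shows "ip (\<lambda>x. f x + t * g x) (\<lambda>x. f x + t * g x) = ip f f + 2 * t * ip f g + t\<^sup>2 * ip g g"
proof -
  let ?g = "\<lambda>x. t * g x" and ?s = "\<lambda>x. f x + t * g x"
  have H: "?g \<in> H" "?s \<in> H" using assms by (auto intro: add_mem scale_mem)
  have "ip ?s ?s = ip f ?s + t * ip g ?s"
    using assms H by (simp add: ip_add_left ip_scale_left)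
  also have "ip f ?s = ip f f + t * ip f g"
    using assms H by (simp add: ip_commute[of f ?s] ip_add_left ip_scale_left ip_commute[of g f])
  also have "ip g ?s = ip f g + t * ip g g"
    using assms H by (simp add: ip_commute[of g ?s] ip_add_left ip_scale_left)
  finally show ?thesis by (simp add: algebra_simps power2_eq_square)
qed

text \<open>The substitute for definiteness: a vector of norm zero cannot be seen by the inner
  product, even if it is not the zero function.\<close>

lemma ip_null_left:
  assumes "e \<in> H" "f \<in> H" "ip e e = 0"
  shows "ip e f = 0"
proof (rule linear_form_zero_if_quadratic_nonneg[OF ip_nonneg[OF assms(2)]])
  fix t
  have "0 \<le> ip (\<lambda>x. e x + (- t) * f x) (\<lambda>x. e x + (- t) * f x)"
    using assms by (intro ip_nonneg add_mem scale_mem)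
  also have "\<dots> = t\<^sup>2 * ip f f - 2 * t * ip e f"
    using assms by (subst ip_add_scaled_square) auto
  finally show "0 \<le> t\<^sup>2 * ip f f - 2 * t * ip e f" .
qed

lemma lin_comb_mem:
  assumes "\<And>i. i < p \<Longrightarrow> \<psi> i \<in> H"
  shows "lin_comb p \<psi> \<alpha> \<in> H"
  using assms unfolding lin_comb_def
proof (induction p)
  case (Suc p)
  then have "(\<lambda>x. (\<Sum>i<p. \<alpha> $ i * \<psi> i x) + \<alpha> $ p * \<psi> p x) \<in> H"
    by (intro add_mem scale_mem) auto
  then show ?case by simp
qed (simp add: zero_mem)

lemma ip_lin_comb_left:
  assumes "\<And>i. i < p \<Longrightarrow> \<psi> i \<in> H" "h \<in> H"
  shows "ip (lin_comb p \<psi> \<alpha>) h = (\<Sum>i<p. \<alpha> $ i * ip (\<psi> i) h)"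
  using assms
proof (induction p)
  case (Suc p)
  have "lin_comb p \<psi> \<alpha> \<in> H" using Suc.prems by (intro lin_comb_mem) auto
  then have "ip (\<lambda>x. lin_comb p \<psi> \<alpha> x + \<alpha> $ p * \<psi> p x) h
      = ip (lin_comb p \<psi> \<alpha>) h + \<alpha> $ p * ip (\<psi> p) h"
    using Suc.prems by (simp add: ip_add_left scale_mem ip_scale_left)
  then show ?case using Suc by (simp add: lin_comb_def)
qed (simp add: lin_comb_def ip_zero_left)

lemma normal_equations_iff_orthogonal:
  assumes "\<And>i. i < p \<Longrightarrow> \<psi> i \<in> H" "f \<in> H" "i < p"
  shows "(\<Sum>j<p. ip (\<psi> i) (\<psi> j) * v $ j) = ip (\<psi> i) f
    \<longleftrightarrow> ip (\<lambda>x. f x - lin_comb p \<psi> v x) (\<psi> i) = 0"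
proof -
  have "(\<Sum>j<p. ip (\<psi> i) (\<psi> j) * v $ j) = ip (lin_comb p \<psi> v) (\<psi> i)"
    using assms by (subst ip_lin_comb_left) (auto intro!: sum.cong simp: ip_commute[of "\<psi> i" "\<psi> _"] mult.commute)
  then show ?thesis
    using assms by (auto simp: ip_diff_left lin_comb_mem ip_commute[of "\<psi> i" f])
qed

text \<open>Both sides say that the residual \<open>r\<close> is orthogonal to every
  \<open>\<psi> i\<close>. A minimizer satisfies this by perturbing a single coefficient;
  conversely, Pythagoras gives any competitor the additional error \<open>ip d d\<close>, where
  \<open>d\<close> is the difference of the two approximations.\<close>

theorem best_approx_iff_normal_equations:
  assumes psi: "\<And>i. i < p \<Longrightarrow> \<psi> i \<in> H" and f: "f \<in> H" and v: "v \<in> carrier_vec p"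
  shows "best_approx H ip p \<psi> f (lin_comb p \<psi> v)
    \<longleftrightarrow> (\<forall>i<p. (\<Sum>j<p. ip (\<psi> i) (\<psi> j) * v $ j) = ip (\<psi> i) f)"
proof -
  define r where "r = (\<lambda>x. f x - lin_comb p \<psi> v x)"
  have r: "r \<in> H" unfolding r_def by (intro diff_mem f lin_comb_mem psi)
  have "best_approx H ip p \<psi> f (lin_comb p \<psi> v) \<longleftrightarrow>
      (\<forall>\<beta>\<in>carrier_vec p. ip r r \<le> ip (\<lambda>x. f x - lin_comb p \<psi> \<beta> x) (\<lambda>x. f x - lin_comb p \<psi> \<beta> x))"
    using psi f v by (auto simp: best_approx_def r_def)
  also have "\<dots> \<longleftrightarrow> (\<forall>i<p. ip r (\<psi> i) = 0)"
  proof (intro iffI allI impI ballI)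
    fix i
    assume min: "\<forall>\<beta>\<in>carrier_vec p.
        ip r r \<le> ip (\<lambda>x. f x - lin_comb p \<psi> \<beta> x) (\<lambda>x. f x - lin_comb p \<psi> \<beta> x)"
      and i: "i < p"
    show "ip r (\<psi> i) = 0"
    proof (rule linear_form_zero_if_quadratic_nonneg[OF ip_nonneg[OF psi[OF i]]])
      fix t
      define \<beta> where "\<beta> = vec p (\<lambda>j. v $ j + (if j = i then t else 0))"
      have "lin_comb p \<psi> \<beta> x = lin_comb p \<psi> v x + t * \<psi> i x" for x
        using i by (simp add: lin_comb_def \<beta>_def distrib_right sum.distrib if_distrib[of "\<lambda>c. c * _"]
            sum.delta cong: if_cong)
      then have "(\<lambda>x. f x - lin_comb p \<psi> \<beta> x) = (\<lambda>x. r x + (- t) * \<psi> i x)"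
        by (auto simp: r_def)
      moreover have "\<beta> \<in> carrier_vec p" by (simp add: \<beta>_def)
      ultimately have "ip r r \<le> ip (\<lambda>x. r x + (- t) * \<psi> i x) (\<lambda>x. r x + (- t) * \<psi> i x)"
        using min by metis
      then show "0 \<le> t\<^sup>2 * ip (\<psi> i) (\<psi> i) - 2 * t * ip r (\<psi> i)"
        using ip_add_scaled_square[OF r psi[OF i], of "- t"] by simp
    qed
  next
    fix \<beta> :: "real vec"
    assume orth: "\<forall>i<p. ip r (\<psi> i) = 0" and \<beta>: "\<beta> \<in> carrier_vec p"
    define d where "d = lin_comb p \<psi> (v - \<beta>)"
    have d: "d \<in> H" unfolding d_def by (intro lin_comb_mem psi)
    have "f x - lin_comb p \<psi> \<beta> x = r x + 1 * d x" for x
      using v \<beta> by (simp add: r_def d_def lin_comb_def left_diff_distrib sum_subtractf)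
    then have "ip (\<lambda>x. f x - lin_comb p \<psi> \<beta> x) (\<lambda>x. f x - lin_comb p \<psi> \<beta> x)
        = ip (\<lambda>x. r x + 1 * d x) (\<lambda>x. r x + 1 * d x)" by simp
    also have "\<dots> = ip r r + 2 * ip r d + ip d d"
      by (subst ip_add_scaled_square) (use r d in auto)
    also have "ip r d = (\<Sum>i<p. (v - \<beta>) $ i * ip (\<psi> i) r)"
      unfolding ip_commute[OF r d] unfolding d_def using r by (intro ip_lin_comb_left psi)
    also have "\<dots> = 0"
      using orth r psi by (intro sum.neutral) (auto simp: ip_commute[OF psi r])
    finally show "ip r r \<le> ip (\<lambda>x. f x - lin_comb p \<psi> \<beta> x) (\<lambda>x. f x - lin_comb p \<psi> \<beta> x)"
      using ip_nonneg[OF d] by simp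
  qed
  also have "\<dots> \<longleftrightarrow> (\<forall>i<p. (\<Sum>j<p. ip (\<psi> i) (\<psi> j) * v $ j) = ip (\<psi> i) f)"
    using normal_equations_iff_orthogonal[where \<psi> = \<psi> and p = p and f = f and v = v] psi f
    unfolding r_def by auto
  finally show ?thesis .
qed

text \<open>One Gram-Schmidt step per basis function: with \<open>r\<close> and \<open>e\<close> the
  residuals of \<open>f\<close> and of \<open>\<psi> p\<close> against the earlier functions,
  subtracting from \<open>r\<close> its component along \<open>e\<close> makes it orthogonal to
  \<open>\<psi> p\<close> as well. A dependent \<open>\<psi> p\<close> gives a null \<open>e\<close>
  and needs no correction.\<close>

theorem normal_equations_solvable:
  assumes "\<And>i. i < p \<Longrightarrow> \<psi> i \<in> H" and "f \<in> H"
  shows "\<exists>v\<in>carrier_vec p. \<forall>i<p. (\<Sum>j<p. ip (\<psi> i) (\<psi> j) * v $ j) = ip (\<psi> i) f"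
proof -
  \<comment> \<open>Coefficients are plain functions here, so that lengthening the family involves
    no vector dimensions. The induction keeps \<open>f\<close> arbitrary, because its hypothesis is
    also applied to \<open>\<psi> p\<close>.\<close>
  have "\<exists>c. \<forall>i<p. ip (\<lambda>x. f x - (\<Sum>j<p. c j * \<psi> j x)) (\<psi> i) = 0"
    if "\<And>i. i < p \<Longrightarrow> \<psi> i \<in> H" and "f \<in> H" for f
    using that
  proof (induction p arbitrary: f)
    case (Suc p)
    have comb: "(\<lambda>x. \<Sum>j<p. c j * \<psi> j x) \<in> H" for c
      using lin_comb_mem[of p \<psi> "vec p c"] Suc.prems(1) by (simp add: lin_comb_def)
    obtain a where a: "\<forall>i<p. ip (\<lambda>x. f x - (\<Sum>j<p. a j * \<psi> j x)) (\<psi> i) = 0"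
      using Suc.IH[of f] Suc.prems by auto
    obtain b where b: "\<forall>i<p. ip (\<lambda>x. \<psi> p x - (\<Sum>j<p. b j * \<psi> j x)) (\<psi> i) = 0"
      using Suc.IH[of "\<psi> p"] Suc.prems by auto
    define r where "r = (\<lambda>x. f x - (\<Sum>j<p. a j * \<psi> j x))"
    define q where "q = (\<lambda>x. \<Sum>j<p. b j * \<psi> j x)"
    define e where "e = (\<lambda>x. \<psi> p x - q x)"
    have H: "r \<in> H" "q \<in> H" "e \<in> H" "\<psi> p \<in> H"
      unfolding r_def q_def e_def using Suc.prems comb by (auto intro: diff_mem)
    have perp: "ip h q = 0" if "h \<in> H" "\<forall>i<p. ip h (\<psi> i) = 0" for h
    proof -
      have "ip h q = ip (lin_comb p \<psi> (vec p b)) h"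
        using ip_commute[OF that(1) H(2)] by (simp add: q_def lin_comb_def)
      also have "\<dots> = (\<Sum>i<p. vec p b $ i * ip (\<psi> i) h)"
        using Suc.prems(1) that(1) by (intro ip_lin_comb_left) auto
      also have "\<dots> = 0"
        using that Suc.prems(1) by (intro sum.neutral) (auto simp: ip_commute[OF _ that(1)])
      finally show ?thesis .
    qed
    \<comment> \<open>The default 0 is correct for null \<open>e\<close>, since then
      \<open>ip e r = 0\<close> by \<open>ip_null_left\<close>.\<close>
    define t where "t = (if ip e e = 0 then 0 else ip e r / ip e e)"
    let ?c = "\<lambda>j. if j < p then a j - t * b j else t"
    have res: "(\<lambda>x. f x - (\<Sum>j<Suc p. ?c j * \<psi> j x)) = (\<lambda>x. r x - t * e x)"
      by (simp add: r_def e_def q_def algebra_simps sum_subtractf sum_distrib_left)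
    have te: "(\<lambda>x. t * e x) \<in> H" using H by (intro scale_mem)
    have ip_res: "ip (\<lambda>x. r x - t * e x) h = ip r h - t * ip e h" if "h \<in> H" for h
      using H te that by (simp add: ip_diff_left ip_scale_left)
    have low: "ip (\<lambda>x. r x - t * e x) (\<psi> i) = 0" if "i < p" for i
    proof -
      have "ip r (\<psi> i) = 0" "ip e (\<psi> i) = 0"
        using a b that unfolding r_def e_def q_def by blast+
      then show ?thesis using that Suc.prems(1)[of i] by (simp add: ip_res)
    qed
    \<comment> \<open>As \<open>\<psi> p\<close> is the sum of \<open>e\<close> and
      \<open>q\<close>, it suffices to be orthogonal to \<open>e\<close>, by the choice of
      \<open>t\<close>, and to \<open>q\<close>, a combination of the earlier functions.\<close>
    have "ip (\<lambda>x. r x - t * e x) (\<psi> p) = 0"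
    proof -
      have "ip (\<lambda>x. r x - t * e x) e = 0"
        unfolding ip_res[OF H(3)] using ip_null_left[OF H(3,1)]
        by (auto simp: t_def ip_commute[OF H(1) H(3)])
      moreover have "ip (\<lambda>x. r x - t * e x) q = 0"
        using low H te by (intro perp diff_mem) auto
      moreover have "ip s e = ip s (\<psi> p) - ip s q" if "s \<in> H" for s
        using ip_diff_left[OF H(4,2) that] ip_commute[OF H(3) that]
          ip_commute[OF H(4) that] ip_commute[OF H(2) that] by (simp add: e_def)
      ultimately show ?thesis using diff_mem[OF H(1) te] by simp
    qed
    with low have "\<forall>i<Suc p. ip (\<lambda>x. f x - (\<Sum>j<Suc p. ?c j * \<psi> j x)) (\<psi> i) = 0"
      unfolding res by (auto simp: less_Suc_eq)
    then show ?case by (intro exI[of _ ?c])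
  qed simp
  then obtain c where "\<forall>i<p. ip (\<lambda>x. f x - (\<Sum>j<p. c j * \<psi> j x)) (\<psi> i) = 0"
    using assms by meson
  then have "\<forall>i<p. ip (\<lambda>x. f x - lin_comb p \<psi> (vec p c) x) (\<psi> i) = 0"
    by (simp add: lin_comb_def)
  then have "\<forall>i<p. (\<Sum>j<p. ip (\<psi> i) (\<psi> j) * vec p c $ j) = ip (\<psi> i) f"
    using normal_equations_iff_orthogonal[where \<psi> = \<psi> and p = p and f = f and v = "vec p c"] assms
    by simp
  then show ?thesis by (intro bexI[of _ "vec p c"]) auto
qed

end

section \<open>Square integrable functions and weighted samples as instances\<close>

lemma L2_mult_integrable:
  assumes "f \<in> L2 \<mu>" "g \<in> L2 \<mu>"
  shows "integrable \<mu> (\<lambda>x. f x * g x)"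
proof (rule Bochner_Integration.integrable_bound)
  show "integrable \<mu> (\<lambda>x. (f x)\<^sup>2 + (g x)\<^sup>2)" using assms by (simp add: L2_def)
  show "(\<lambda>x. f x * g x) \<in> borel_measurable \<mu>" using assms by (auto simp: L2_def)
  show "AE x in \<mu>. norm (f x * g x) \<le> norm ((f x)\<^sup>2 + (g x)\<^sup>2)"
  proof (intro AE_I2)
    fix x
    have "2 * (\<bar>f x\<bar> * \<bar>g x\<bar>) \<le> \<bar>f x\<bar>\<^sup>2 + \<bar>g x\<bar>\<^sup>2"
      using sum_squares_bound[of "\<bar>f x\<bar>" "\<bar>g x\<bar>"] by (simp only: mult.assoc)
    moreover have "0 \<le> \<bar>f x\<bar> * \<bar>g x\<bar>" by simp
    ultimately have "\<bar>f x\<bar> * \<bar>g x\<bar> \<le> \<bar>f x\<bar>\<^sup>2 + \<bar>g x\<bar>\<^sup>2" by linarith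
    then show "norm (f x * g x) \<le> norm ((f x)\<^sup>2 + (g x)\<^sup>2)" by (simp add: abs_mult)
  qed
qed

interpretation L2: semi_inner_function_space "L2 \<mu>" "ip_L2 \<mu>" for \<mu> :: "'x measure"
proof
  fix f g h :: "'x \<Rightarrow> real" and c
  show "(\<lambda>_. 0) \<in> L2 \<mu>" by (simp add: L2_def)
  show "(\<lambda>x. c * f x) \<in> L2 \<mu>" if "f \<in> L2 \<mu>"
    using that by (auto simp: L2_def power_mult_distrib)
  show "(\<lambda>x. f x + g x) \<in> L2 \<mu>" if "f \<in> L2 \<mu>" "g \<in> L2 \<mu>"
    using that L2_mult_integrable[OF that] by (auto simp: L2_def power2_sum mult.assoc)
  show "ip_L2 \<mu> f g = ip_L2 \<mu> g f" by (simp add: ip_L2_def mult.commute)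
  show "ip_L2 \<mu> (\<lambda>x. f x + g x) h = ip_L2 \<mu> f h + ip_L2 \<mu> g h"
    if "f \<in> L2 \<mu>" "g \<in> L2 \<mu>" "h \<in> L2 \<mu>"
    using that by (simp add: ip_L2_def distrib_right L2_mult_integrable)
  show "ip_L2 \<mu> (\<lambda>x. c * f x) h = c * ip_L2 \<mu> f h"
    by (simp add: ip_L2_def mult.assoc)
  show "0 \<le> ip_L2 \<mu> f f"
    by (simp add: ip_L2_def)
qed

lemma discrete_semi_inner_function_space:
  assumes "\<And>k. k < m \<Longrightarrow> 0 \<le> w k"
  shows "semi_inner_function_space (R_space m) (ip_discrete m w)"
proof
  show "0 \<le> ip_discrete m w f f" for f
    by (auto simp: ip_discrete_def intro!: sum_nonneg mult_nonneg_nonneg[OF zero_le_square] assms)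
qed (auto simp: R_space_def ip_discrete_def algebra_simps sum.distrib sum_distrib_left)

section \<open>The pseudoinverse of a symmetric matrix\<close>

text \<open>Penrose's argument. Symmetry gives
  \<open>P Q = (P Q' P Q)^T = (P Q) (P Q') = P Q'\<close>, the dual computation gives
  \<open>Q P = Q' P\<close>, and then \<open>Q = Q P Q = Q' P Q = Q' P Q' = Q'\<close>.\<close>

lemma is_pinv_unique:
  assumes "is_pinv P Q" "is_pinv P Q'"
  shows "Q = Q'"
proof -
  define n where "n = dim_row P"
  define k where "k = dim_col P"
  have P: "P \<in> carrier_mat n k" by (simp add: n_def k_def)
  have Q: "Q \<in> carrier_mat k n" "Q' \<in> carrier_mat k n"
    using assms by (auto simp: is_pinv_def n_def k_def)
  note car = P Q
  have T: "transpose_mat (A * B) = transpose_mat B * transpose_mat A"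
    if "A \<in> carrier_mat a b" "B \<in> carrier_mat b c" for A B :: "real mat" and a b c
    using transpose_mult[OF that] .
  have eqs: "P * Q * P = P" "P * Q' * P = P"
    using assms by (simp_all add: is_pinv_def)
  have PQ: "P * Q = P * Q'"
  proof -
    have "P * Q = transpose_mat (P * Q' * P * Q)"
      unfolding eqs using assms by (simp add: is_pinv_def)
    also have "P * Q' * P * Q = (P * Q') * (P * Q)"
      by (rule assoc_mult_mat[of _ n n _ k _ n]) (use car in auto)
    also have "transpose_mat \<dots> = transpose_mat (P * Q) * transpose_mat (P * Q')"
      by (rule T[of _ n n _ n]) (use car in auto)
    also have "\<dots> = P * Q * (P * Q')" using assms by (simp add: is_pinv_def)
    also have "\<dots> = P * Q * P * Q'"
      by (rule assoc_mult_mat[of _ n n _ k _ n, symmetric]) (use car in auto)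
    finally show ?thesis unfolding eqs .
  qed
  have QP: "Q * P = Q' * P"
  proof -
    have "Q * P = transpose_mat (Q * (P * Q' * P))"
      unfolding eqs using assms by (simp add: is_pinv_def)
    also have "Q * (P * Q' * P) = Q * (P * (Q' * P))"
      by (rule arg_cong[of _ _ "(*) Q"], rule assoc_mult_mat[of _ n k _ n _ k]) (use car in auto)
    also have "\<dots> = (Q * P) * (Q' * P)"
      by (rule assoc_mult_mat[of _ k n _ k _ k, symmetric]) (use car in auto)
    also have "transpose_mat \<dots> = transpose_mat (Q' * P) * transpose_mat (Q * P)"
      by (rule T[of _ k k _ k]) (use car in auto)
    also have "\<dots> = Q' * P * (Q * P)" using assms by (simp add: is_pinv_def)
    also have "\<dots> = Q' * (P * (Q * P))"
      by (rule assoc_mult_mat[of _ k n _ k _ k]) (use car in auto)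
    also have "\<dots> = Q' * (P * Q * P)"
      by (rule arg_cong[of _ _ "(*) Q'"], rule assoc_mult_mat[of _ n k _ n _ k, symmetric]) (use car in auto)
    finally show ?thesis unfolding eqs .
  qed
  have "Q = Q * P * Q" using assms by (simp add: is_pinv_def)
  also have "\<dots> = Q' * P * Q" by (simp only: QP)
  also have "\<dots> = Q' * (P * Q)" by (rule assoc_mult_mat[of _ k n _ k _ n]) (use car in auto)
  also have "\<dots> = Q' * (P * Q')" by (simp only: PQ)
  also have "\<dots> = Q' * P * Q'" by (rule assoc_mult_mat[of _ k n _ k _ n, symmetric]) (use car in auto)
  also have "\<dots> = Q'" using assms by (simp add: is_pinv_def)
  finally show ?thesis .
qed

lemma mult_mat_index_sum:
  assumes "A \<in> carrier_mat n k" "B \<in> carrier_mat k m" "i < n" "j < m"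
  shows "(A * B) $$ (i, j) = (\<Sum>l<k. A $$ (i, l) * B $$ (l, j))"
  using assms by (simp add: scalar_prod_def atLeast0LessThan)

lemma mult_mat_vec_index_sum:
  assumes "A \<in> carrier_mat n k" "v \<in> carrier_vec k" "i < n"
  shows "(A *\<^sub>v v) $ i = (\<Sum>l<k. A $$ (i, l) * v $ l)"
  using assms by (auto simp: scalar_prod_def atLeast0LessThan)

text \<open>Column \<open>c\<close> of \<open>V\<close> is a least squares solution of \<open>R v = e\<^sub>c\<close>.\<close>

lemma symmetric_factor_through_square:
  fixes R :: "real mat"
  assumes R: "R \<in> carrier_mat n n" and sym: "transpose_mat R = R"
  shows "\<exists>V\<in>carrier_mat n n. R * (R * V) = R"
proof -
  interpret semi_inner_function_space "R_space n" "ip_discrete n (\<lambda>_. 1)"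
    by (rule discrete_semi_inner_function_space) simp
  have Rsym: "R $$ (i, j) = R $$ (j, i)" if "i < n" "j < n" for i j
    using that R sym by (metis carrier_matD index_transpose_mat(1))
  define \<psi> where "\<psi> = (\<lambda>j k. if k < n then R $$ (k, j) else 0)"
  define u where "u = (\<lambda>c k :: nat. if k = c then 1 else 0 :: real)"
  have "\<exists>v\<in>carrier_vec n. \<forall>i<n. (\<Sum>j<n. ip_discrete n (\<lambda>_. 1) (\<psi> i) (\<psi> j) * v $ j)
      = ip_discrete n (\<lambda>_. 1) (\<psi> i) (u c)" if "c < n" for c
    using that by (intro normal_equations_solvable) (auto simp: R_space_def \<psi>_def u_def)
  then obtain v where v: "\<And>c i. c < n \<Longrightarrow> i < n \<Longrightarrow>
      (\<Sum>j<n. ip_discrete n (\<lambda>_. 1) (\<psi> i) (\<psi> j) * v c $ j) = ip_discrete n (\<lambda>_. 1) (\<psi> i) (u c)"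
    by metis
  define V where "V = mat n n (\<lambda>(j, c). v c $ j)"
  have V: "V \<in> carrier_mat n n" by (simp add: V_def)
  have "R * R * V = R"
  proof (rule eq_matI)
    fix i c assume "i < dim_row R" "c < dim_col R"
    then have ic: "i < n" "c < n" using R by auto
    \<comment> \<open>The \<open>\<psi> i\<close> are the columns of \<open>R\<close>, so by
      symmetry their Gram matrix is \<open>R * R\<close>, and the right-hand side for the unit
      vector \<open>u c\<close> is column \<open>c\<close> of \<open>R\<close>. Solving for every
      \<open>c\<close> yields \<open>R * R * V = R\<close>.\<close>
    have "(R * R) $$ (i, j) = ip_discrete n (\<lambda>_. 1) (\<psi> i) (\<psi> j)" if "j < n" for j
      using R ic that by (auto simp: scalar_prod_def ip_discrete_def \<psi>_def Rsym[of i]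
          atLeast0LessThan intro!: sum.cong)
    then have "(R * R * V) $$ (i, c) = (\<Sum>j<n. ip_discrete n (\<lambda>_. 1) (\<psi> i) (\<psi> j) * v c $ j)"
      using mult_mat_index_sum[OF mult_carrier_mat[OF R R] V ic] ic by (simp add: V_def)
    also have "\<dots> = R $$ (c, i)"
      using v ic by (simp add: ip_discrete_def u_def \<psi>_def if_distrib[of "\<lambda>x. _ * x"] cong: if_cong)
    finally show "(R * R * V) $$ (i, c) = R $$ (i, c)" using Rsym ic by simp
  qed (use R V in auto)
  then show ?thesis using R V by (auto simp: assoc_mult_mat)
qed

text \<open>If \<open>R\<^sup>2 V = R\<close>, then \<open>R V = V\<^sup>T R\<close> is the orthogonal projection onto the range of \<open>R\<close>,
  and \<open>V\<^sup>T R V\<close> is the pseudoinverse.\<close>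

theorem symmetric_is_pinv:
  assumes R: "R \<in> carrier_mat n n" and sym: "transpose_mat R = R"
  shows "is_pinv R (pinv R)"
proof -
  obtain V where V: "V \<in> carrier_mat n n" and RRV: "R * (R * V) = R"
    using symmetric_factor_through_square[OF assms] by blast
  define W where "W = transpose_mat V"
  have W: "W \<in> carrier_mat n n" using V by (simp add: W_def)
  note car = R V W
  have assoc: "A * B * C = A * (B * C)"
    if "A \<in> carrier_mat n n" "B \<in> carrier_mat n n" "C \<in> carrier_mat n n" for A B C :: "real mat"
    using that by (rule assoc_mult_mat)
  have "R = transpose_mat (R * (R * V))" using RRV sym by simp
  also have "\<dots> = W * R * R"
    using car sym by (simp add: transpose_mult[of _ n n _ n] W_def)
  finally have WRR: "W * (R * R) = R" using car by (simp add: assoc)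
  \<comment> \<open>Both sides equal \<open>W * R * R * V\<close>, by inserting one or the other
    factorization of \<open>R\<close>.\<close>
  have WR: "W * R = R * V"
  proof -
    have "W * R = W * (R * (R * V))" by (simp only: RRV)
    also have "\<dots> = W * (R * R) * V" using car by (simp add: assoc)
    finally show ?thesis by (simp only: WRR)
  qed
  define Q where "Q = W * (R * V)"
  have Q: "Q \<in> carrier_mat n n" using car by (simp add: Q_def)
  have RQ: "R * Q = R * V"
  proof -
    have "R * Q = R * (W * R) * V" using car by (simp add: Q_def assoc)
    also have "\<dots> = R * (R * V) * V" by (simp only: WR)
    finally show ?thesis by (simp only: RRV)
  qed
  have QR: "Q * R = R * V"
  proof -
    have "Q * R = W * ((R * V) * R)" using car by (simp add: Q_def assoc)
    also have "\<dots> = W * (W * (R * R))" using car by (simp add: WR[symmetric] assoc)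
    finally show ?thesis by (simp only: WRR WR)
  qed
  have symE: "transpose_mat (R * V) = R * V"
    using car sym by (simp add: transpose_mult[of _ n n _ n] W_def[symmetric] WR)
  have "is_pinv R Q"
    unfolding is_pinv_def
  proof (intro conjI)
    show "R * Q * R = R"
    proof -
      have "R * Q * R = W * (R * R)" using car by (simp add: RQ WR[symmetric] assoc)
      then show ?thesis by (simp only: WRR)
    qed
    show "Q * R * Q = Q"
    proof -
      \<comment> \<open>In this form \<open>Q\<close> is the projection \<open>R * V\<close> applied
        to \<open>V\<close>, so \<open>Q * R * Q = Q\<close> reduces to idempotence.\<close>
      have Q': "Q = R * V * V"
        unfolding WR[symmetric] using car by (simp add: Q_def assoc)
      have "R * V * (R * V) = W * R * (R * V)" by (simp only: WR)
      also have "\<dots> = W * (R * (R * V))" using car by (intro assoc) auto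
      finally have idem: "R * V * (R * V) = R * V" by (simp only: RRV WR)
      have "Q * R * Q = R * V * (R * V * V)" by (simp only: QR Q'[symmetric])
      also have "\<dots> = R * V * (R * V) * V" using car by (intro assoc[symmetric]) auto
      finally show ?thesis by (simp only: idem Q')
    qed
  qed (use R Q in \<open>auto simp: RQ QR symE\<close>)
  then show ?thesis
    unfolding pinv_def by (rule theI) (rule is_pinv_unique[OF _ \<open>is_pinv R Q\<close>])
qed

lemma pinv_solves:
  assumes R: "R \<in> carrier_mat n n" and sym: "transpose_mat R = R"
    and u: "u \<in> carrier_vec n" "R *\<^sub>v u = s"
  shows "pinv R *\<^sub>v s \<in> carrier_vec n" "R *\<^sub>v (pinv R *\<^sub>v s) = s"
proof -
  have Q: "pinv R \<in> carrier_mat n n" and RQR: "R * pinv R * R = R"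
    using symmetric_is_pinv[OF R sym] R by (auto simp: is_pinv_def)
  show "pinv R *\<^sub>v s \<in> carrier_vec n" using Q R u by auto
  have "R *\<^sub>v (pinv R *\<^sub>v s) = R * pinv R * R *\<^sub>v u"
    using Q R u by (simp add: assoc_mult_mat_vec[of _ n n _ n])
  then show "R *\<^sub>v (pinv R *\<^sub>v s) = s" using RQR u by simp
qed

section \<open>Linear systems with a Gram matrix\<close>

lemma mult_mat_vec_eq_iff:
  assumes "A \<in> carrier_mat n p" "v \<in> carrier_vec p" "s \<in> carrier_vec n"
  shows "A *\<^sub>v v = s \<longleftrightarrow> (\<forall>i<n. (\<Sum>j<p. A $$ (i, j) * v $ j) = s $ i)"
proof
  assume "A *\<^sub>v v = s"
  then show "\<forall>i<n. (\<Sum>j<p. A $$ (i, j) * v $ j) = s $ i"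
    using mult_mat_vec_index_sum[OF assms(1,2)] by metis
next
  assume *: "\<forall>i<n. (\<Sum>j<p. A $$ (i, j) * v $ j) = s $ i"
  show "A *\<^sub>v v = s"
  proof (rule eq_vecI)
    show "(A *\<^sub>v v) $ i = s $ i" if "i < dim_vec s" for i
      using that * assms(3) mult_mat_vec_index_sum[OF assms(1,2), of i] by simp
  qed (use assms in auto)
qed

text \<open>The factor \<open>w\<close> is the constant weight of a discrete inner product, which
  the matrix \<open>R\<close> itself does not contain; being nonzero, it cancels from the normal
  equations. The continuous case uses \<open>w = 1\<close>. Symmetry of \<open>R\<close> comes from
  \<open>ip_commute\<close>, and consistency of the system lets the pseudoinverse solve it
  exactly.\<close>

lemma (in semi_inner_function_space) gram_system:
  assumes psi: "\<And>i. i < p \<Longrightarrow> \<psi> i \<in> H" and f: "f \<in> H"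
    and R: "R \<in> carrier_mat p p" "\<And>i j. i < p \<Longrightarrow> j < p \<Longrightarrow> w * R $$ (i, j) = ip (\<psi> i) (\<psi> j)"
    and s: "s \<in> carrier_vec p" "\<And>i. i < p \<Longrightarrow> w * s $ i = ip (\<psi> i) f"
    and w: "w \<noteq> (0::real)"
  shows gram_system_iff_best_approx: "v \<in> carrier_vec p \<Longrightarrow>
      R *\<^sub>v v = s \<longleftrightarrow> best_approx H ip p \<psi> f (lin_comb p \<psi> v)"
    and pinv_gram_carrier: "pinv R *\<^sub>v s \<in> carrier_vec p"
    and pinv_gram_solves: "R *\<^sub>v (pinv R *\<^sub>v s) = s"
proof -
  have eq: "R *\<^sub>v v = s \<longleftrightarrow> (\<forall>i<p. (\<Sum>j<p. ip (\<psi> i) (\<psi> j) * v $ j) = ip (\<psi> i) f)"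
    if "v \<in> carrier_vec p" for v
  proof -
    have "(\<Sum>j<p. ip (\<psi> i) (\<psi> j) * v $ j) = w * (\<Sum>j<p. R $$ (i, j) * v $ j)" if "i < p" for i
      unfolding sum_distrib_left
      by (rule sum.cong[OF refl]) (use R(2)[OF that] in \<open>simp add: mult.assoc[symmetric]\<close>)
    then show ?thesis
      unfolding mult_mat_vec_eq_iff[OF R(1) that s(1)]
      using w s(2)[symmetric] by simp
  qed
  then show "v \<in> carrier_vec p \<Longrightarrow>
      R *\<^sub>v v = s \<longleftrightarrow> best_approx H ip p \<psi> f (lin_comb p \<psi> v)"
    using best_approx_iff_normal_equations[of p \<psi> f v, OF psi f] by simp
  obtain u where u: "u \<in> carrier_vec p" "R *\<^sub>v u = s"
    using normal_equations_solvable[of p \<psi> f, OF psi f] eq by blast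
  have "transpose_mat R = R"
  proof (rule eq_matI)
    fix i j assume "i < dim_row R" "j < dim_col R"
    then have ij: "i < p" "j < p" using R(1) by auto
    have "w * R $$ (j, i) = w * R $$ (i, j)"
      using ij R(2) ip_commute[OF psi[OF ij(1)] psi[OF ij(2)]] by simp
    then show "transpose_mat R $$ (i, j) = R $$ (i, j)" using w ij R(1) by simp
  qed (use R(1) in auto)
  from pinv_solves[OF R(1) this u]
  show "pinv R *\<^sub>v s \<in> carrier_vec p" "R *\<^sub>v (pinv R *\<^sub>v s) = s" .
qed

section \<open>The QENDy system as a Gram system\<close>

lemma block3_vec_index:
  assumes "i < dim_vec u + dim_vec v + 1"
  shows "block3_vec u v c $ i =
    (if i < dim_vec u then u $ i else if i < dim_vec u + dim_vec v then v $ (i - dim_vec u) else c)"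
  using assms by (auto simp: block3_vec_def)

lemma dim_block3_vec: "dim_vec (block3_vec u v c) = dim_vec u + dim_vec v + 1"
  by (simp add: block3_vec_def)

lemma block3_carrier:
  assumes "P \<in> carrier_mat p p" "T \<in> carrier_mat q q"
  shows "block3 P Q u S T v a b c \<in> carrier_mat (p + q + 1) (p + q + 1)"
  using assms unfolding block3_def by (intro four_block_carrier_mat) auto

lemma block3_index:
  assumes "P \<in> carrier_mat p p" "Q \<in> carrier_mat p q" "u \<in> carrier_vec p"
    "S \<in> carrier_mat q p" "T \<in> carrier_mat q q" "v \<in> carrier_vec q"
    "a \<in> carrier_vec p" "b \<in> carrier_vec q"
    and "i < p + q + 1" "j < p + q + 1"
  shows "block3 P Q u S T v a b c $$ (i, j) =
    (if i < p then
       if j < p then P $$ (i, j) else if j < p + q then Q $$ (i, j - p) else u $ i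
     else if i < p + q then
       if j < p then S $$ (i - p, j) else if j < p + q then T $$ (i - p, j - p) else v $ (i - p)
     else
       if j < p then a $ j else if j < p + q then b $ (j - p) else c)"
  using assms by (auto simp: block3_def mat_of_cols_index mat_of_rows_index)

lemma pair_idx_less: "i < N \<Longrightarrow> j < N \<Longrightarrow> pair_idx N i j < N\<^sup>2"
proof -
  assume i: "i < N" and j: "j < N"
  have "N * j + i < N * j + N" using i by simp
  also have "\<dots> = N * Suc j" by simp
  also have "\<dots> \<le> N * N" using j by (intro mult_le_mono2) simp
  finally show ?thesis by (simp add: pair_idx_def power2_eq_square)
qed

lemma mod_div_pair_idx:
  assumes "i < N"
  shows "pair_idx N i j mod N = i" "pair_idx N i j div N = j"
  using assms by (simp_all add: pair_idx_def)

lemma pair_components_less: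
  assumes "a < (N::nat)\<^sup>2"
  shows "a mod N < N" "a div N < N"
  using assms by (cases "N = 0"; simp add: power2_eq_square less_mult_imp_div_less)+

lemma aug_basis_simps:
  "a < N\<^sup>2 \<Longrightarrow> aug_basis N \<phi> a = feat_prod \<phi> (a mod N) (a div N)"
  "i < N \<Longrightarrow> aug_basis N \<phi> (N\<^sup>2 + i) = \<phi> i"
  "aug_basis N \<phi> (N\<^sup>2 + N) = (\<lambda>_. 1)"
  by (auto simp: aug_basis_def)

lemma aug_basis_pair_idx:
  "i < N \<Longrightarrow> j < N \<Longrightarrow> aug_basis N \<phi> (pair_idx N i j) = feat_prod \<phi> i j"
  by (simp add: aug_basis_simps pair_idx_less mod_div_pair_idx)

lemma Z_carrier [simp]:
  "Z1 N \<phi> m x \<in> carrier_mat N m" "Z2 N \<phi> m x \<in> carrier_mat (N\<^sup>2) m"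
  "Zdot N \<psi> m y yd \<in> carrier_mat N m"
  using mat_of_cols_carrier(1)[of N "map (\<lambda>k. feat N \<phi> (x k)) [0..<m]"]
    mat_of_cols_carrier(1)[of "N\<^sup>2" "map (\<lambda>k. kron_vec (feat N \<phi> (x k)) (feat N \<phi> (x k))) [0..<m]"]
    mat_of_cols_carrier(1)[of N "map (\<lambda>k. feat_dot N \<psi> (y k) (yd k)) [0..<m]"]
  by (simp_all add: Z1_def Z2_def Zdot_def)

lemma ones_vec_carrier [simp]: "ones_vec m \<in> carrier_vec m"
  by (simp add: ones_vec_def)

text \<open>\<open>kron_vec\<close> indexes its first factor by \<open>a div N\<close>, whereas
  \<open>aug_basis\<close> lists \<open>a mod N\<close> first. The orders agree because both
  Kronecker factors are the same vector.\<close>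

lemma Z_index:
  "i < N \<Longrightarrow> k < m \<Longrightarrow> Z1 N \<phi> m x $$ (i, k) = aug_basis N \<phi> (N\<^sup>2 + i) (x k)"
  "a < N\<^sup>2 \<Longrightarrow> k < m \<Longrightarrow> Z2 N \<phi> m x $$ (a, k) = aug_basis N \<phi> a (x k)"
  using pair_components_less[of a N]
  by (simp_all add: Z1_def Z2_def mat_of_cols_index feat_def aug_basis_simps kron_vec_def feat_prod_def
      power2_eq_square[symmetric])

lemma Zdot_index:
  assumes "l < N" "k < m" "xd k = F (x k)"
  shows "Zdot N \<phi> m x xd $$ (l, k) = grad_dot F \<phi> l (x k)"
  using assms by (simp add: Zdot_def mat_of_cols_index feat_dot_def grad_dot_def)

lemma mult_transpose_index_sum:
  assumes "A \<in> carrier_mat n m" "B \<in> carrier_mat k m" "i < n" "j < k"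
  shows "(A * transpose_mat B) $$ (i, j) = (\<Sum>l<m. A $$ (i, l) * B $$ (j, l))"
  using assms by (simp add: scalar_prod_def atLeast0LessThan)

lemma mult_transpose_carrier:
  "A \<in> carrier_mat n m \<Longrightarrow> B \<in> carrier_mat k m \<Longrightarrow> A * transpose_mat B \<in> carrier_mat n k"
  by (rule mult_carrier_mat) simp_all

lemma qendy_R_carrier: "qendy_R N \<phi> m x \<in> carrier_mat (aug_dim N) (aug_dim N)"
  unfolding qendy_R_def Let_def
  by (intro block3_carrier mult_transpose_carrier[of _ _ m] Z_carrier)

lemma Z_products_index:
  fixes x :: "nat \<Rightarrow> 'a" and N :: nat and \<phi>
  defines "g \<equiv> \<lambda>a b m. \<Sum>k<m. aug_basis N \<phi> a (x k) * aug_basis N \<phi> b (x k)"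
  shows "a < N\<^sup>2 \<Longrightarrow> b < N\<^sup>2 \<Longrightarrow> (Z2 N \<phi> m x * transpose_mat (Z2 N \<phi> m x)) $$ (a, b) = g a b m"
    and "a < N\<^sup>2 \<Longrightarrow> j < N \<Longrightarrow> (Z2 N \<phi> m x * transpose_mat (Z1 N \<phi> m x)) $$ (a, j) = g a (N\<^sup>2 + j) m"
    and "i < N \<Longrightarrow> b < N\<^sup>2 \<Longrightarrow> (Z1 N \<phi> m x * transpose_mat (Z2 N \<phi> m x)) $$ (i, b) = g (N\<^sup>2 + i) b m"
    and "i < N \<Longrightarrow> j < N \<Longrightarrow>
      (Z1 N \<phi> m x * transpose_mat (Z1 N \<phi> m x)) $$ (i, j) = g (N\<^sup>2 + i) (N\<^sup>2 + j) m"
    and "a < N\<^sup>2 \<Longrightarrow> (Z2 N \<phi> m x *\<^sub>v ones_vec m) $ a = g a (N\<^sup>2 + N) m"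
    and "i < N \<Longrightarrow> (Z1 N \<phi> m x *\<^sub>v ones_vec m) $ i = g (N\<^sup>2 + i) (N\<^sup>2 + N) m"
  unfolding g_def
       apply (subst mult_transpose_index_sum[of _ "N\<^sup>2" m _ "N\<^sup>2"]; simp add: Z_index)
      apply (subst mult_transpose_index_sum[of _ "N\<^sup>2" m _ N]; simp add: Z_index)
     apply (subst mult_transpose_index_sum[of _ N m _ "N\<^sup>2"]; simp add: Z_index)
    apply (subst mult_transpose_index_sum[of _ N m _ N]; simp add: Z_index)
   apply (subst mult_mat_vec_index_sum[of _ "N\<^sup>2" m]; simp add: Z_index ones_vec_def aug_basis_simps(3))
  apply (subst mult_mat_vec_index_sum[of _ N m]; simp add: Z_index ones_vec_def aug_basis_simps(3))
  done

text \<open>Stacking \<open>Z2\<close>, \<open>Z1\<close> and a row of ones gives the matrix of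
  values of the augmented basis at the data points, and \<open>R\<close> is this matrix times its
  transpose. The corner entry \<open>real m\<close> is the sum for the constant function with
  itself.\<close>

lemma qendy_R_index:
  assumes "a < aug_dim N" "b < aug_dim N"
  shows "qendy_R N \<phi> m x $$ (a, b) = (\<Sum>k<m. aug_basis N \<phi> a (x k) * aug_basis N \<phi> b (x k))"
proof -
  let ?P = "Z2 N \<phi> m x" and ?Q = "Z1 N \<phi> m x" and ?e = "ones_vec m"
  have last: "aug_basis N \<phi> i = (\<lambda>_. 1)" if "\<not> i < N\<^sup>2 + N" for i
    using that by (auto simp: aug_basis_def)
  note car = mult_transpose_carrier[of _ _ m] mult_mat_vec_carrier[of _ _ m] Z_carrier ones_vec_carrier
  have "qendy_R N \<phi> m x $$ (a, b) =
    (if a < N\<^sup>2 then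
       if b < N\<^sup>2 then (?P * transpose_mat ?P) $$ (a, b)
       else if b < N\<^sup>2 + N then (?P * transpose_mat ?Q) $$ (a, b - N\<^sup>2) else (?P *\<^sub>v ?e) $ a
     else if a < N\<^sup>2 + N then
       if b < N\<^sup>2 then (?Q * transpose_mat ?P) $$ (a - N\<^sup>2, b)
       else if b < N\<^sup>2 + N then (?Q * transpose_mat ?Q) $$ (a - N\<^sup>2, b - N\<^sup>2)
       else (?Q *\<^sub>v ?e) $ (a - N\<^sup>2)
     else
       if b < N\<^sup>2 then (?P *\<^sub>v ?e) $ b
       else if b < N\<^sup>2 + N then (?Q *\<^sub>v ?e) $ (b - N\<^sup>2) else real m)"
    unfolding qendy_R_def Let_def by (intro block3_index car assms)
  then show ?thesis using assms by (simp add: Z_products_index last mult.commute del: index_mult_mat index_mult_mat_vec)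
qed

lemma qendy_s_dim: "qendy_s N \<phi> m x xd l \<in> carrier_vec (aug_dim N)"
  by (intro carrier_vecI) (simp add: qendy_s_def Let_def dim_block3_vec Z_carrier[THEN carrier_matD(1)])

lemma Z_rhs_index:
  fixes x xd :: "nat \<Rightarrow> 'a::real_inner" and N m l :: nat and \<phi> F
  assumes l: "l < N" and xd: "\<And>k. k < m \<Longrightarrow> xd k = F (x k)"
  defines "d \<equiv> row (Zdot N \<phi> m x xd) l"
    and "h \<equiv> \<lambda>a. \<Sum>k<m. aug_basis N \<phi> a (x k) * grad_dot F \<phi> l (x k)"
  shows "a < N\<^sup>2 \<Longrightarrow> (Z2 N \<phi> m x *\<^sub>v d) $ a = h a"
    and "i < N \<Longrightarrow> (Z1 N \<phi> m x *\<^sub>v d) $ i = h (N\<^sup>2 + i)"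
    and "ones_vec m \<bullet> d = h (N\<^sup>2 + N)"
proof -
  have dc: "d \<in> carrier_vec m" unfolding d_def by (intro row_carrier_vec[OF l] Z_carrier)
  have d: "d $ k = grad_dot F \<phi> l (x k)" if "k < m" for k
    using that l xd Z_carrier(3)[of N \<phi> m x xd, THEN carrier_matD(1)]
      Z_carrier(3)[of N \<phi> m x xd, THEN carrier_matD(2)] by (simp add: d_def Zdot_index)
  show "(Z2 N \<phi> m x *\<^sub>v d) $ a = h a" if "a < N\<^sup>2"
    using that by (subst mult_mat_vec_index_sum[OF _ dc, of _ "N\<^sup>2"]) (auto simp: Z_index d h_def)
  show "(Z1 N \<phi> m x *\<^sub>v d) $ i = h (N\<^sup>2 + i)" if "i < N"
    using that by (subst mult_mat_vec_index_sum[OF _ dc, of _ N]) (auto simp: Z_index d h_def)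
  show "ones_vec m \<bullet> d = h (N\<^sup>2 + N)"
    using dc by (simp add: scalar_prod_def ones_vec_def atLeast0LessThan d h_def aug_basis_simps(3))
qed

lemma qendy_s_index:
  assumes "a < aug_dim N" "l < N" "\<And>k. k < m \<Longrightarrow> xd k = F (x k)"
  shows "qendy_s N \<phi> m x xd l $ a = (\<Sum>k<m. aug_basis N \<phi> a (x k) * grad_dot F \<phi> l (x k))"
proof -
  have last: "aug_basis N \<phi> i = (\<lambda>_. 1)" if "\<not> i < N\<^sup>2 + N" for i
    using that by (auto simp: aug_basis_def)
  note rhs = Z_rhs_index[where xd = xd and F = F, OF assms(2,3)]
  show ?thesis
    unfolding qendy_s_def Let_def
    by (subst block3_vec_index)
      (use assms(1) in \<open>auto simp: Z_carrier[THEN carrier_matD(1)] rhs last simp del: index_mult_mat_vec\<close>)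
qed

section \<open>The limit system and the linear dependence of the basis\<close>

lemma limit_R_carrier: "limit_R \<mu> N \<phi> \<in> carrier_mat (aug_dim N) (aug_dim N)"
  unfolding limit_R_def Let_def by (rule block3_carrier) auto

lemma limit_R_index:
  assumes "a < aug_dim N" "b < aug_dim N"
  shows "limit_R \<mu> N \<phi> $$ (a, b) = ip_L2 \<mu> (aug_basis N \<phi> a) (aug_basis N \<phi> b)"
  unfolding limit_R_def Let_def
  by (subst block3_index[of _ "N\<^sup>2" _ N]) (use assms in \<open>auto simp: aug_basis_def\<close>)

lemma limit_s_index:
  assumes "a < aug_dim N"
  shows "limit_s \<mu> N \<phi> F l $ a = ip_L2 \<mu> (aug_basis N \<phi> a) (grad_dot F \<phi> l)"
  unfolding limit_s_def Let_def
  by (subst block3_vec_index) (use assms in \<open>auto simp: aug_basis_def\<close>)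

lemma limit_s_carrier: "limit_s \<mu> N \<phi> F l \<in> carrier_vec (aug_dim N)"
  by (intro carrier_vecI) (simp add: limit_s_def Let_def dim_block3_vec)

text \<open>For every \<open>\<phi>\<close>, the products of \<open>\<phi> 0\<close> and
  \<open>\<phi> 1\<close> in either order are the same function but occupy two different positions
  of the family; \<open>c\<close> is the difference of the corresponding unit vectors.\<close>

lemma aug_basis_dependent:
  assumes "2 \<le> N"
  shows "\<exists>c\<in>carrier_vec (aug_dim N).
    c \<noteq> 0\<^sub>v (aug_dim N) \<and> lin_comb (aug_dim N) (aug_basis N \<phi>) c = (\<lambda>_. 0)"
proof -
  let ?n = "aug_dim N" and ?a = "pair_idx N 0 1" and ?b = "pair_idx N 1 0"
  define c where "c = vec ?n (\<lambda>i. (if i = ?a then 1 else 0) - (if i = ?b then 1 else 0 :: real))"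
  have less: "?a < ?n" "?b < ?n" using assms pair_idx_less[of 0 N 1] pair_idx_less[of 1 N 0] by auto
  have ne: "?a \<noteq> ?b" using assms by (simp add: pair_idx_def)
  have "c $ ?a = 1" using less ne by (simp add: c_def)
  then have "c \<noteq> 0\<^sub>v ?n" using less by auto
  moreover have "lin_comb ?n (aug_basis N \<phi>) c x = 0" for x
  proof -
    have "lin_comb ?n (aug_basis N \<phi>) c x = aug_basis N \<phi> ?a x - aug_basis N \<phi> ?b x"
      using less by (simp add: lin_comb_def c_def left_diff_distrib sum_subtractf
          if_distrib[of "\<lambda>t. t * _"] cong: if_cong)
    then show ?thesis using assms by (simp add: aug_basis_pair_idx feat_prod_def)
  qed
  ultimately show ?thesis by (intro bexI[of _ c]) (auto simp: c_def)
qed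

section \<open>The Frobenius objective, row by row\<close>

lemma lin_comb_at_data:
  "lin_comb p (\<lambda>a. at_data m x (\<psi> a)) v = at_data m x (lin_comb p \<psi> v)"
  by (auto simp: lin_comb_def at_data_def)

lemma at_data_mem: "at_data m x f \<in> R_space m"
  by (simp add: at_data_def R_space_def)

lemma sum_lessThan_add:
  fixes f :: "nat \<Rightarrow> 'b::comm_monoid_add"
  shows "(\<Sum>i<p + q. f i) = (\<Sum>i<p. f i) + (\<Sum>i<q. f (p + i))"
  by (induction q) (simp_all add: add.assoc)

lemma lin_comb_aug_basis_block3_vec:
  assumes "A \<in> carrier_vec (N\<^sup>2)" "B \<in> carrier_vec N"
  shows "lin_comb (aug_dim N) (aug_basis N \<phi>) (block3_vec A B c) x =
    (\<Sum>a<N\<^sup>2. A $ a * aug_basis N \<phi> a x) + (\<Sum>i<N. B $ i * aug_basis N \<phi> (N\<^sup>2 + i) x) + c"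
  unfolding lin_comb_def
  using assms by (simp add: sum_lessThan_add block3_vec_index aug_basis_simps(3))

text \<open>Entry \<open>(l, k)\<close> of the residual matrix is the error at data point
  \<open>k\<close> of approximating \<open>grad_dot F \<phi> l\<close> with coefficients read from
  row \<open>l\<close> alone.\<close>

lemma qendy_residual_frob_norm:
  assumes A: "A \<in> carrier_mat N (N\<^sup>2)" and B: "B \<in> carrier_mat N N" and C: "C \<in> carrier_vec N"
    and xd: "\<And>k. k < m \<Longrightarrow> xd k = F (x k)"
  shows "(frob_norm (Zdot N \<phi> m x xd - A * Z2 N \<phi> m x - B * Z1 N \<phi> m x
      - mat_of_cols N [C] * mat_of_rows m [ones_vec m]))\<^sup>2 =
    (\<Sum>l<N. \<Sum>k<m. (grad_dot F \<phi> l (x k) -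
      lin_comb (aug_dim N) (aug_basis N \<phi>) (block3_vec (row A l) (row B l) (C $ l)) (x k))\<^sup>2)"
    (is "(frob_norm ?E)\<^sup>2 = ?rhs")
proof -
  let ?CC = "mat_of_cols N [C] * mat_of_rows m [ones_vec m]"
  have CC: "?CC \<in> carrier_mat N m" by (rule mult_carrier_mat[of _ N 1]) auto
  have AZ: "A * Z2 N \<phi> m x \<in> carrier_mat N m" using A Z_carrier(2) by (rule mult_carrier_mat)
  have BZ: "B * Z1 N \<phi> m x \<in> carrier_mat N m" using B Z_carrier(1) by (rule mult_carrier_mat)
  note car = CC AZ BZ Z_carrier(3)[of N \<phi> m x xd]
  have E: "?E \<in> carrier_mat N m" using car by (intro minus_carrier_mat)
  have entry: "?E $$ (l, k) = grad_dot F \<phi> l (x k) -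
      lin_comb (aug_dim N) (aug_basis N \<phi>) (block3_vec (row A l) (row B l) (C $ l)) (x k)"
    if l: "l < N" and k: "k < m" for l k
  proof -
    have "?E $$ (l, k) = Zdot N \<phi> m x xd $$ (l, k) - (A * Z2 N \<phi> m x) $$ (l, k)
        - (B * Z1 N \<phi> m x) $$ (l, k) - ?CC $$ (l, k)"
      using car l k by (simp del: index_mult_mat)
    also have "(A * Z2 N \<phi> m x) $$ (l, k) = (\<Sum>a<N\<^sup>2. row A l $ a * aug_basis N \<phi> a (x k))"
      using A l k by (subst mult_mat_index_sum[OF A Z_carrier(2) l k]) (simp add: Z_index)
    also have "(B * Z1 N \<phi> m x) $$ (l, k) = (\<Sum>i<N. row B l $ i * aug_basis N \<phi> (N\<^sup>2 + i) (x k))"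
      using B l k by (subst mult_mat_index_sum[OF B Z_carrier(1) l k]) (simp add: Z_index)
    also have "?CC $$ (l, k) = C $ l"
      using l k C by (subst mult_mat_index_sum[of _ N 1 _ m])
        (auto simp: mat_of_cols_index mat_of_rows_index ones_vec_def)
    also have "Zdot N \<phi> m x xd $$ (l, k) = grad_dot F \<phi> l (x k)"
      using Zdot_index l k xd by blast
    finally show ?thesis
      using lin_comb_aug_basis_block3_vec[OF row_carrier_vec[OF l A] row_carrier_vec[OF l B],
          of \<phi> "C $ l" "x k"] by simp
  qed
  have "(frob_norm ?E)\<^sup>2 = (\<Sum>l<N. \<Sum>k<m. (?E $$ (l, k))\<^sup>2)"
    using E by (simp add: frob_norm_def sum_nonneg del: index_minus_mat)
  also have "\<dots> = ?rhs" using entry by (intro sum.cong) simp_all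
  finally show ?thesis .
qed

text \<open>No constraint couples the components, so one of them can be replaced by
  \<open>\<beta>\<close> while all the other summands cancel.\<close>

lemma minimizes_sum_iff_minimizes_each:
  fixes E :: "nat \<Rightarrow> 'b \<Rightarrow> real"
  assumes "\<And>l. l < N \<Longrightarrow> v l \<in> V"
  shows "(\<forall>u. (\<forall>l<N. u l \<in> V) \<longrightarrow> (\<Sum>l<N. E l (v l)) \<le> (\<Sum>l<N. E l (u l))) \<longleftrightarrow>
    (\<forall>l<N. \<forall>\<beta>\<in>V. E l (v l) \<le> E l \<beta>)"
proof (intro iffI allI impI ballI)
  fix l \<beta>
  assume min: "\<forall>u. (\<forall>l<N. u l \<in> V) \<longrightarrow> (\<Sum>l<N. E l (v l)) \<le> (\<Sum>l<N. E l (u l))"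
    and l: "l < N" and \<beta>: "\<beta> \<in> V"
  have "(\<Sum>i<N. E i (v i)) \<le> (\<Sum>i<N. E i ((v(l := \<beta>)) i))"
    using min assms \<beta> by auto
  also have "\<dots> = E l \<beta> + (\<Sum>i\<in>{..<N} - {l}. E i ((v(l := \<beta>)) i))"
    using l by (subst sum.remove[of _ l]) auto
  also have "(\<Sum>i\<in>{..<N} - {l}. E i ((v(l := \<beta>)) i)) = (\<Sum>i\<in>{..<N} - {l}. E i (v i))"
    by (intro sum.cong) auto
  also have "(\<Sum>i<N. E i (v i)) = E l (v l) + (\<Sum>i\<in>{..<N} - {l}. E i (v i))"
    using l by (subst sum.remove[of _ l]) auto
  finally show "E l (v l) \<le> E l \<beta>" by simp
next
  fix u assume "\<forall>l<N. \<forall>\<beta>\<in>V. E l (v l) \<le> E l \<beta>" "\<forall>l<N. u l \<in> V"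
  then show "(\<Sum>l<N. E l (v l)) \<le> (\<Sum>l<N. E l (u l))" by (intro sum_mono) auto
qed

text \<open>The objective is a sum over rows, triples \<open>(A, B, C)\<close> range over all
  families of coefficient vectors, and a positive constant weight leaves the minimizers
  unchanged.\<close>

lemma is_qendy_fit_iff:
  assumes A: "A \<in> carrier_mat N (N\<^sup>2)" and B: "B \<in> carrier_mat N N" and C: "C \<in> carrier_vec N"
    and xd: "\<And>k. k < m \<Longrightarrow> xd k = F (x k)" and w: "0 < w"
  shows "is_qendy_fit N \<phi> m x xd A B C \<longleftrightarrow>
    (\<forall>l<N. best_approx (R_space m) (ip_discrete m (\<lambda>_. w)) (aug_dim N)
      (\<lambda>a. at_data m x (aug_basis N \<phi> a)) (at_data m x (grad_dot F \<phi> l))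
      (lin_comb (aug_dim N) (\<lambda>a. at_data m x (aug_basis N \<phi> a)) (block3_vec (row A l) (row B l) (C $ l))))"
proof -
  let ?V = "carrier_vec (aug_dim N) :: real vec set"
  define rows where "rows = (\<lambda>A B C l. block3_vec (row A l) (row B l) (C $ l :: real))"
  define E where "E = (\<lambda>l v. \<Sum>k<m. (grad_dot F \<phi> l (x k) - lin_comb (aug_dim N) (aug_basis N \<phi>) v (x k))\<^sup>2)"
  have rows: "rows A B C l \<in> ?V"
    if "A \<in> carrier_mat N (N\<^sup>2)" "B \<in> carrier_mat N N" for A B C l
    using that by (intro carrier_vecI) (simp add: rows_def dim_block3_vec)
  have err: "(frob_norm (Zdot N \<phi> m x xd - A * Z2 N \<phi> m x - B * Z1 N \<phi> m x
      - mat_of_cols N [C] * mat_of_rows m [ones_vec m]))\<^sup>2 = (\<Sum>l<N. E l (rows A B C l))"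
    if "A \<in> carrier_mat N (N\<^sup>2)" "B \<in> carrier_mat N N" "C \<in> carrier_vec N" for A B C
    unfolding E_def rows_def by (rule qendy_residual_frob_norm[OF that]) (rule xd)
  \<comment> \<open>Any family of coefficient vectors can be cut into rows of \<open>A\<close> and
    \<open>B\<close> and entries of \<open>C\<close>; this makes the row problems
    independent.\<close>
  have surj: "\<exists>A\<in>carrier_mat N (N\<^sup>2). \<exists>B\<in>carrier_mat N N. \<exists>C\<in>carrier_vec N. \<forall>l<N. rows A B C l = u l"
    if u: "\<forall>l<N. u l \<in> ?V" for u
  proof -
    let ?A = "mat N (N\<^sup>2) (\<lambda>(l, a). u l $ a)" and ?B = "mat N N (\<lambda>(l, i). u l $ (N\<^sup>2 + i))"
      and ?C = "vec N (\<lambda>l. u l $ (N\<^sup>2 + N))"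
    have "rows ?A ?B ?C l = u l" if l: "l < N" for l
    proof (rule eq_vecI)
      have dim: "dim_vec (u l) = aug_dim N" using u l by auto
      show "dim_vec (rows ?A ?B ?C l) = dim_vec (u l)" using dim by (simp add: rows_def dim_block3_vec)
      fix i assume "i < dim_vec (u l)"
      then have i: "i < N\<^sup>2 + N + 1" using dim by simp
      then show "rows ?A ?B ?C l $ i = u l $ i"
        using l less_Suc_eq[of i "N\<^sup>2 + N"] by (auto simp: rows_def block3_vec_index)
    qed
    then show ?thesis by (intro bexI[of _ ?A] bexI[of _ ?B] bexI[of _ ?C]) auto
  qed
  have "is_qendy_fit N \<phi> m x xd A B C \<longleftrightarrow>
      (\<forall>A'\<in>carrier_mat N (N\<^sup>2). \<forall>B'\<in>carrier_mat N N. \<forall>C'\<in>carrier_vec N.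
        (\<Sum>l<N. E l (rows A B C l)) \<le> (\<Sum>l<N. E l (rows A' B' C' l)))"
    unfolding is_qendy_fit_def Let_def using A B C by (simp add: err)
  also have "\<dots> \<longleftrightarrow> (\<forall>u. (\<forall>l<N. u l \<in> ?V) \<longrightarrow> (\<Sum>l<N. E l (rows A B C l)) \<le> (\<Sum>l<N. E l (u l)))"
  proof (intro iffI allI impI ballI)
    fix u
    assume *: "\<forall>A'\<in>carrier_mat N (N\<^sup>2). \<forall>B'\<in>carrier_mat N N. \<forall>C'\<in>carrier_vec N.
        (\<Sum>l<N. E l (rows A B C l)) \<le> (\<Sum>l<N. E l (rows A' B' C' l))"
      and u: "\<forall>l<N. u l \<in> ?V"
    from surj[OF u] obtain A' B' C' where abc: "A' \<in> carrier_mat N (N\<^sup>2)" "B' \<in> carrier_mat N N"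
      "C' \<in> carrier_vec N" "\<forall>l<N. rows A' B' C' l = u l" by blast
    have "(\<Sum>l<N. E l (rows A B C l)) \<le> (\<Sum>l<N. E l (rows A' B' C' l))" using * abc by blast
    also have "\<dots> = (\<Sum>l<N. E l (u l))" using abc(4) by (intro sum.cong) auto
    finally show "(\<Sum>l<N. E l (rows A B C l)) \<le> (\<Sum>l<N. E l (u l))" .
  next
    fix A' B' :: "real mat" and C' :: "real vec"
    assume *: "\<forall>u. (\<forall>l<N. u l \<in> ?V) \<longrightarrow> (\<Sum>l<N. E l (rows A B C l)) \<le> (\<Sum>l<N. E l (u l))"
      and abc: "A' \<in> carrier_mat N (N\<^sup>2)" "B' \<in> carrier_mat N N"
    show "(\<Sum>l<N. E l (rows A B C l)) \<le> (\<Sum>l<N. E l (rows A' B' C' l))"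
      by (rule *[rule_format]) (rule rows[OF abc])
  qed
  also have "\<dots> \<longleftrightarrow> (\<forall>l<N. \<forall>\<beta>\<in>?V. E l (rows A B C l) \<le> E l \<beta>)"
    by (rule minimizes_sum_iff_minimizes_each) (rule rows[OF A B])
  also have "\<dots> \<longleftrightarrow> (\<forall>l<N. best_approx (R_space m) (ip_discrete m (\<lambda>_. w)) (aug_dim N)
      (\<lambda>a. at_data m x (aug_basis N \<phi> a)) (at_data m x (grad_dot F \<phi> l))
      (lin_comb (aug_dim N) (\<lambda>a. at_data m x (aug_basis N \<phi> a)) (rows A B C l)))"
  proof -
    have dist: "ip_discrete m (\<lambda>_. w) (\<lambda>k. at_data m x (grad_dot F \<phi> l) k - at_data m x g k)
        (\<lambda>k. at_data m x (grad_dot F \<phi> l) k - at_data m x g k)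
      = w * (\<Sum>k<m. (grad_dot F \<phi> l (x k) - g (x k))\<^sup>2)" for l g
      by (simp add: ip_discrete_def at_data_def power2_eq_square sum_distrib_left mult.commute)
    show ?thesis
      unfolding best_approx_def lin_comb_at_data dist E_def
      using w rows[OF A B] by (auto simp: at_data_mem)
  qed
  finally show ?thesis unfolding rows_def .
qed

text \<open>On a finite measure space the constant 1 lies in L2, so the squares
  \<open>\<phi> i * \<phi> i\<close>, being in L2, are integrable, which puts
  \<open>\<phi> i\<close> itself in L2. Measurability of \<open>\<phi> i\<close> is a separate
  hypothesis because measurability of a square does not imply it.\<close>

lemma aug_basis_L2:
  assumes "finite_measure \<mu>"
    and meas: "\<And>i. i < N \<Longrightarrow> \<phi> i \<in> borel_measurable \<mu>"
    and prods: "\<And>i j. i < N \<Longrightarrow> j < N \<Longrightarrow> feat_prod \<phi> i j \<in> L2 \<mu>"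
    and a: "a < aug_dim N"
  shows "aug_basis N \<phi> a \<in> L2 \<mu>"
proof -
  interpret finite_measure \<mu> by fact
  have one: "(\<lambda>_. 1) \<in> L2 \<mu>" by (simp add: L2_def)
  consider "a < N\<^sup>2" | i where "i < N" "a = N\<^sup>2 + i" | "a = N\<^sup>2 + N"
    using a by (metis Suc_eq_plus1 add_less_cancel_left le_Suc_ex less_SucE not_less)
  then show ?thesis
  proof cases
    case 1
    then show ?thesis using prods pair_components_less[of a N] by (simp add: aug_basis_simps)
  next
    case 2
    have "integrable \<mu> (\<lambda>x. feat_prod \<phi> i i x * 1)"
      using L2_mult_integrable[OF prods[OF 2(1) 2(1)] one] .
    then have "integrable \<mu> (\<lambda>x. (\<phi> i x)\<^sup>2)" by (simp add: feat_prod_def power2_eq_square)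
    then show ?thesis using 2 meas by (simp add: aug_basis_simps L2_def)
  next
    case 3
    then show ?thesis using one by (simp add: aug_basis_simps)
  qed
qed

section \<open>Assembly of the limits and of the two kinds of best approximation\<close>

theorem mainTheorem3:
  fixes F :: "real ^ 'n \<Rightarrow> real ^ 'n"
    and \<phi> :: "nat \<Rightarrow> real ^ 'n \<Rightarrow> real"
    and N :: nat
    and \<mu> :: "(real ^ 'n) measure"
    and M :: "'w measure"
    and X Xdot :: "nat \<Rightarrow> 'w \<Rightarrow> real ^ 'n"
  assumes N: "CARD('n) < N"
    and diff: "\<And>i x. i < N \<Longrightarrow> \<phi> i differentiable (at x)"
    and prob: "prob_space M"
    and indep: "prob_space.indep_vars M (\<lambda>_. borel) X UNIV"
    and distr: "\<And>k. distr M borel (X k) = \<mu>"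
    and deriv: "\<And>k \<omega>. \<omega> \<in> space M \<Longrightarrow> Xdot k \<omega> = F (X k \<omega>)"
    and feat_L2: "\<And>i j. i < N \<Longrightarrow> j < N \<Longrightarrow> feat_prod \<phi> i j \<in> L2 \<mu>"
    and grad_L2: "\<And>l. l < N \<Longrightarrow> grad_dot F \<phi> l \<in> L2 \<mu>"
  shows
    "(AE \<omega> in M.
      (let P = (\<lambda>m. Z2 N \<phi> m (\<lambda>k. X k \<omega>));
           Q = (\<lambda>m. Z1 N \<phi> m (\<lambda>k. X k \<omega>));
           d = (\<lambda>m l. row (Zdot N \<phi> m (\<lambda>k. X k \<omega>) (\<lambda>k. Xdot k \<omega>)) l);
           e = ones_vec;
           one = (\<lambda>_. 1)
       in
        (\<forall>i1<N. \<forall>i2<N. \<forall>j1<N. \<forall>j2<N.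
          (\<lambda>m. ((1 / real m) \<cdot>\<^sub>m (P m * transpose_mat (P m))) $$ (pair_idx N i1 i2, pair_idx N j1 j2))
            \<longlonglongrightarrow> ip_L2 \<mu> (feat_prod \<phi> i1 i2) (feat_prod \<phi> j1 j2)) \<and>
        (\<forall>i1<N. \<forall>i2<N. \<forall>j<N.
          (\<lambda>m. ((1 / real m) \<cdot>\<^sub>m (P m * transpose_mat (Q m))) $$ (pair_idx N i1 i2, j))
            \<longlonglongrightarrow> ip_L2 \<mu> (feat_prod \<phi> i1 i2) (\<phi> j)) \<and>
        (\<forall>i1<N. \<forall>i2<N.
          (\<lambda>m. ((1 / real m) \<cdot>\<^sub>v (P m *\<^sub>v e m)) $ pair_idx N i1 i2)
            \<longlonglongrightarrow> ip_L2 \<mu> (feat_prod \<phi> i1 i2) one) \<and>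
        (\<forall>i<N. \<forall>j<N.
          (\<lambda>m. ((1 / real m) \<cdot>\<^sub>m (Q m * transpose_mat (Q m))) $$ (i, j))
            \<longlonglongrightarrow> ip_L2 \<mu> (\<phi> i) (\<phi> j)) \<and>
        (\<forall>i<N. (\<lambda>m. ((1 / real m) \<cdot>\<^sub>v (Q m *\<^sub>v e m)) $ i) \<longlonglongrightarrow> ip_L2 \<mu> (\<phi> i) one) \<and>
        (\<forall>l<N. \<forall>i1<N. \<forall>i2<N.
          (\<lambda>m. ((1 / real m) \<cdot>\<^sub>v (P m *\<^sub>v d m l)) $ pair_idx N i1 i2)
            \<longlonglongrightarrow> ip_L2 \<mu> (feat_prod \<phi> i1 i2) (grad_dot F \<phi> l)) \<and>
        (\<forall>l<N. \<forall>i<N.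
          (\<lambda>m. ((1 / real m) \<cdot>\<^sub>v (Q m *\<^sub>v d m l)) $ i)
            \<longlonglongrightarrow> ip_L2 \<mu> (\<phi> i) (grad_dot F \<phi> l)) \<and>
        (\<forall>l<N. (\<lambda>m. (1 / real m) * (e m \<bullet> d m l)) \<longlonglongrightarrow> ip_L2 \<mu> one (grad_dot F \<phi> l)) \<and>
        (\<forall>a<aug_dim N. \<forall>b<aug_dim N.
          (\<lambda>m. ((1 / real m) \<cdot>\<^sub>m qendy_R N \<phi> m (\<lambda>k. X k \<omega>)) $$ (a, b))
            \<longlonglongrightarrow> limit_R \<mu> N \<phi> $$ (a, b)) \<and>
        (\<forall>l<N. \<forall>a<aug_dim N.
          (\<lambda>m. ((1 / real m) \<cdot>\<^sub>v qendy_s N \<phi> m (\<lambda>k. X k \<omega>) (\<lambda>k. Xdot k \<omega>) l) $ a)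
            \<longlonglongrightarrow> limit_s \<mu> N \<phi> F l $ a))) \<and>
     (\<forall>l<N.
      (\<forall>v\<in>carrier_vec (aug_dim N).
        limit_R \<mu> N \<phi> *\<^sub>v v = limit_s \<mu> N \<phi> F l \<longleftrightarrow>
        best_approx (L2 \<mu>) (ip_L2 \<mu>) (aug_dim N) (aug_basis N \<phi>) (grad_dot F \<phi> l)
          (lin_comb (aug_dim N) (aug_basis N \<phi>) v)) \<and>
      (let v = pinv (limit_R \<mu> N \<phi>) *\<^sub>v limit_s \<mu> N \<phi> F l in
        v \<in> carrier_vec (aug_dim N) \<and>
        limit_R \<mu> N \<phi> *\<^sub>v v = limit_s \<mu> N \<phi> F l \<and>
        best_approx (L2 \<mu>) (ip_L2 \<mu>) (aug_dim N) (aug_basis N \<phi>) (grad_dot F \<phi> l)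
          (lin_comb (aug_dim N) (aug_basis N \<phi>) v))) \<and>
     (\<exists>c\<in>carrier_vec (aug_dim N).
      c \<noteq> 0\<^sub>v (aug_dim N) \<and> lin_comb (aug_dim N) (aug_basis N \<phi>) c = (\<lambda>_. 0)) \<and>
     (\<forall>m x xd w. 0 < m \<longrightarrow> 0 < w \<longrightarrow> (\<forall>k<m. xd k = F (x k)) \<longrightarrow>
      (let is_best = (\<lambda>l v. best_approx (R_space m) (ip_discrete m (\<lambda>_. w)) (aug_dim N)
              (\<lambda>a. at_data m x (aug_basis N \<phi> a)) (at_data m x (grad_dot F \<phi> l))
              (lin_comb (aug_dim N) (\<lambda>a. at_data m x (aug_basis N \<phi> a)) v))
       in
        (\<forall>l<N. \<forall>v\<in>carrier_vec (aug_dim N).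
          qendy_R N \<phi> m x *\<^sub>v v = qendy_s N \<phi> m x xd l \<longleftrightarrow> is_best l v) \<and>
        (\<forall>l<N.
          qendy_v N \<phi> m x xd l \<in> carrier_vec (aug_dim N) \<and>
          qendy_R N \<phi> m x *\<^sub>v qendy_v N \<phi> m x xd l = qendy_s N \<phi> m x xd l \<and>
          is_best l (qendy_v N \<phi> m x xd l)) \<and>
        (\<forall>A\<in>carrier_mat N (N\<^sup>2). \<forall>B\<in>carrier_mat N N. \<forall>C\<in>carrier_vec N.
          is_qendy_fit N \<phi> m x xd A B C \<longleftrightarrow>
          (\<forall>l<N. is_best l (block3_vec (row A l) (row B l) (C $ l))))))"
proof -
  interpret prob_space M by (rule prob)
  have rv: "random_variable borel (X k)" for k using indep by (auto simp: indep_vars_def)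
  have sets_\<mu>: "sets \<mu> = sets borel" using distr[of 0] by (metis sets_distr)
  have fin: "finite_measure \<mu>"
    using prob_space_distr[OF rv[of 0]] unfolding distr by (simp add: prob_space_def)
  have "\<phi> i \<in> borel_measurable \<mu>" if "i < N" for i
  proof -
    have "continuous_on UNIV (\<phi> i)"
      using diff[OF that] by (simp add: continuous_on_eq_continuous_at differentiable_imp_continuous_within)
    then show ?thesis
      unfolding measurable_cong_sets[OF sets_\<mu> refl] by (rule borel_measurable_continuous_onI)
  qed
  then have aug_L2: "aug_basis N \<phi> a \<in> L2 \<mu>" if "a < aug_dim N" for a
    using that fin feat_L2 by (intro aug_basis_L2)
  show ?thesis
  proof (intro conjI)
    \<comment> \<open>All index quantifiers stand inside \<open>AE\<close>: a countable union of
      null sets yields one exceptional set for all entries.\<close>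
    have "AE \<omega> in M. \<forall>a b. a < aug_dim N \<longrightarrow> b < aug_dim N \<longrightarrow>
        (\<lambda>m. (\<Sum>k<m. aug_basis N \<phi> a (X k \<omega>) * aug_basis N \<phi> b (X k \<omega>)) / real m)
          \<longlonglongrightarrow> ip_L2 \<mu> (aug_basis N \<phi> a) (aug_basis N \<phi> b)"
      unfolding AE_all_countable ip_L2_def
    proof (intro allI)
      fix a b
      show "AE \<omega> in M. a < aug_dim N \<longrightarrow> b < aug_dim N \<longrightarrow>
        (\<lambda>m. (\<Sum>k<m. aug_basis N \<phi> a (X k \<omega>) * aug_basis N \<phi> b (X k \<omega>)) / real m)
          \<longlonglongrightarrow> (\<integral>x. aug_basis N \<phi> a x * aug_basis N \<phi> b x \<partial>\<mu>)"
        using sample_average_tendsto[OF indep distr L2_mult_integrable[OF aug_L2[of a] aug_L2[of b]]]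
        by (cases "a < aug_dim N \<and> b < aug_dim N") auto
    qed
    moreover have "AE \<omega> in M. \<forall>a l. a < aug_dim N \<longrightarrow> l < N \<longrightarrow>
        (\<lambda>m. (\<Sum>k<m. aug_basis N \<phi> a (X k \<omega>) * grad_dot F \<phi> l (X k \<omega>)) / real m)
          \<longlonglongrightarrow> ip_L2 \<mu> (aug_basis N \<phi> a) (grad_dot F \<phi> l)"
      unfolding AE_all_countable ip_L2_def
    proof (intro allI)
      fix a l
      show "AE \<omega> in M. a < aug_dim N \<longrightarrow> l < N \<longrightarrow>
        (\<lambda>m. (\<Sum>k<m. aug_basis N \<phi> a (X k \<omega>) * grad_dot F \<phi> l (X k \<omega>)) / real m)
          \<longlonglongrightarrow> (\<integral>x. aug_basis N \<phi> a x * grad_dot F \<phi> l x \<partial>\<mu>)"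
        using sample_average_tendsto[OF indep distr L2_mult_integrable[OF aug_L2[of a] grad_L2[of l]]]
        by (cases "a < aug_dim N \<and> l < N") auto
    qed
    moreover have "AE \<omega> in M. \<forall>k. Xdot k \<omega> = F (X k \<omega>)" using deriv by (intro AE_I2) blast
    ultimately show "AE \<omega> in M.
      (let P = (\<lambda>m. Z2 N \<phi> m (\<lambda>k. X k \<omega>));
           Q = (\<lambda>m. Z1 N \<phi> m (\<lambda>k. X k \<omega>));
           d = (\<lambda>m l. row (Zdot N \<phi> m (\<lambda>k. X k \<omega>) (\<lambda>k. Xdot k \<omega>)) l);
           e = ones_vec;
           one = (\<lambda>_. 1)
       in (\<forall>i1<N. \<forall>i2<N. \<forall>j1<N. \<forall>j2<N.
          (\<lambda>m. ((1 / real m) \<cdot>\<^sub>m (P m * transpose_mat (P m))) $$ (pair_idx N i1 i2, pair_idx N j1 j2))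
            \<longlonglongrightarrow> ip_L2 \<mu> (feat_prod \<phi> i1 i2) (feat_prod \<phi> j1 j2)) \<and>
        (\<forall>i1<N. \<forall>i2<N. \<forall>j<N.
          (\<lambda>m. ((1 / real m) \<cdot>\<^sub>m (P m * transpose_mat (Q m))) $$ (pair_idx N i1 i2, j))
            \<longlonglongrightarrow> ip_L2 \<mu> (feat_prod \<phi> i1 i2) (\<phi> j)) \<and>
        (\<forall>i1<N. \<forall>i2<N.
          (\<lambda>m. ((1 / real m) \<cdot>\<^sub>v (P m *\<^sub>v e m)) $ pair_idx N i1 i2)
            \<longlonglongrightarrow> ip_L2 \<mu> (feat_prod \<phi> i1 i2) one) \<and>
        (\<forall>i<N. \<forall>j<N.
          (\<lambda>m. ((1 / real m) \<cdot>\<^sub>m (Q m * transpose_mat (Q m))) $$ (i, j))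
            \<longlonglongrightarrow> ip_L2 \<mu> (\<phi> i) (\<phi> j)) \<and>
        (\<forall>i<N. (\<lambda>m. ((1 / real m) \<cdot>\<^sub>v (Q m *\<^sub>v e m)) $ i) \<longlonglongrightarrow> ip_L2 \<mu> (\<phi> i) one) \<and>
        (\<forall>l<N. \<forall>i1<N. \<forall>i2<N.
          (\<lambda>m. ((1 / real m) \<cdot>\<^sub>v (P m *\<^sub>v d m l)) $ pair_idx N i1 i2)
            \<longlonglongrightarrow> ip_L2 \<mu> (feat_prod \<phi> i1 i2) (grad_dot F \<phi> l)) \<and>
        (\<forall>l<N. \<forall>i<N.
          (\<lambda>m. ((1 / real m) \<cdot>\<^sub>v (Q m *\<^sub>v d m l)) $ i)
            \<longlonglongrightarrow> ip_L2 \<mu> (\<phi> i) (grad_dot F \<phi> l)) \<and>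
        (\<forall>l<N. (\<lambda>m. (1 / real m) * (e m \<bullet> d m l)) \<longlonglongrightarrow> ip_L2 \<mu> one (grad_dot F \<phi> l)) \<and>
        (\<forall>a<aug_dim N. \<forall>b<aug_dim N.
          (\<lambda>m. ((1 / real m) \<cdot>\<^sub>m qendy_R N \<phi> m (\<lambda>k. X k \<omega>)) $$ (a, b))
            \<longlonglongrightarrow> limit_R \<mu> N \<phi> $$ (a, b)) \<and>
        (\<forall>l<N. \<forall>a<aug_dim N.
          (\<lambda>m. ((1 / real m) \<cdot>\<^sub>v qendy_s N \<phi> m (\<lambda>k. X k \<omega>) (\<lambda>k. Xdot k \<omega>) l) $ a)
            \<longlonglongrightarrow> limit_s \<mu> N \<phi> F l $ a))"
    proof eventually_elim
      case (elim \<omega>)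
      note gram = elim(1)[rule_format] and rhs = elim(2)[rule_format]
      note Zrhs = Z_rhs_index[where x = "\<lambda>k. X k \<omega>" and xd = "\<lambda>k. Xdot k \<omega>" and F = F, OF _ elim(3)[rule_format]]
      \<comment> \<open>The separate blocks are the instances of \<open>gram\<close> and
        \<open>rhs\<close> at the positions \<open>pair_idx N i j\<close>,
        \<open>N\<^sup>2 + i\<close> and \<open>N\<^sup>2 + N\<close> of the augmented
        basis.\<close>
      note entries = pair_idx_less aug_basis_pair_idx aug_basis_simps(2,3) Z_products_index Zrhs
        Z_carrier[THEN carrier_matD(1)] Z_carrier[THEN carrier_matD(2)] less_SucI trans_less_add1
      show ?case
        unfolding Let_def
      proof (intro conjI allI impI)
        fix i1 i2 j1 j2 assume "i1 < N" "i2 < N" "j1 < N" "j2 < N"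
        then show "(\<lambda>m. ((1 / real m) \<cdot>\<^sub>m (Z2 N \<phi> m (\<lambda>k. X k \<omega>) * transpose_mat (Z2 N \<phi> m (\<lambda>k. X k \<omega>))))
            $$ (pair_idx N i1 i2, pair_idx N j1 j2)) \<longlonglongrightarrow> ip_L2 \<mu> (feat_prod \<phi> i1 i2) (feat_prod \<phi> j1 j2)"
          using gram[of "pair_idx N i1 i2" "pair_idx N j1 j2"] by (simp add: entries del: index_mult_mat(1))
      next
        fix i1 i2 j assume "i1 < N" "i2 < N" "j < N"
        then show "(\<lambda>m. ((1 / real m) \<cdot>\<^sub>m (Z2 N \<phi> m (\<lambda>k. X k \<omega>) * transpose_mat (Z1 N \<phi> m (\<lambda>k. X k \<omega>))))
            $$ (pair_idx N i1 i2, j)) \<longlonglongrightarrow> ip_L2 \<mu> (feat_prod \<phi> i1 i2) (\<phi> j)"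
          using gram[of "pair_idx N i1 i2" "N\<^sup>2 + j"] by (simp add: entries del: index_mult_mat(1))
      next
        fix i1 i2 assume "i1 < N" "i2 < N"
        then show "(\<lambda>m. ((1 / real m) \<cdot>\<^sub>v (Z2 N \<phi> m (\<lambda>k. X k \<omega>) *\<^sub>v ones_vec m)) $ pair_idx N i1 i2)
            \<longlonglongrightarrow> ip_L2 \<mu> (feat_prod \<phi> i1 i2) (\<lambda>_. 1)"
          using gram[of "pair_idx N i1 i2" "N\<^sup>2 + N"] by (simp add: entries del: index_mult_mat_vec)
      next
        fix i j assume "i < N" "j < N"
        then show "(\<lambda>m. ((1 / real m) \<cdot>\<^sub>m (Z1 N \<phi> m (\<lambda>k. X k \<omega>) * transpose_mat (Z1 N \<phi> m (\<lambda>k. X k \<omega>))))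
            $$ (i, j)) \<longlonglongrightarrow> ip_L2 \<mu> (\<phi> i) (\<phi> j)"
          using gram[of "N\<^sup>2 + i" "N\<^sup>2 + j"] by (simp add: entries del: index_mult_mat(1))
      next
        fix i assume "i < N"
        then show "(\<lambda>m. ((1 / real m) \<cdot>\<^sub>v (Z1 N \<phi> m (\<lambda>k. X k \<omega>) *\<^sub>v ones_vec m)) $ i)
            \<longlonglongrightarrow> ip_L2 \<mu> (\<phi> i) (\<lambda>_. 1)"
          using gram[of "N\<^sup>2 + i" "N\<^sup>2 + N"] by (simp add: entries del: index_mult_mat_vec)
      next
        fix l i1 i2 assume "l < N" "i1 < N" "i2 < N"
        then show "(\<lambda>m. ((1 / real m) \<cdot>\<^sub>v (Z2 N \<phi> m (\<lambda>k. X k \<omega>) *\<^sub>v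
            row (Zdot N \<phi> m (\<lambda>k. X k \<omega>) (\<lambda>k. Xdot k \<omega>)) l)) $ pair_idx N i1 i2)
            \<longlonglongrightarrow> ip_L2 \<mu> (feat_prod \<phi> i1 i2) (grad_dot F \<phi> l)"
          using rhs[of "pair_idx N i1 i2" l] by (simp add: entries del: index_mult_mat_vec)
      next
        fix l i assume "l < N" "i < N"
        then show "(\<lambda>m. ((1 / real m) \<cdot>\<^sub>v (Z1 N \<phi> m (\<lambda>k. X k \<omega>) *\<^sub>v
            row (Zdot N \<phi> m (\<lambda>k. X k \<omega>) (\<lambda>k. Xdot k \<omega>)) l)) $ i)
            \<longlonglongrightarrow> ip_L2 \<mu> (\<phi> i) (grad_dot F \<phi> l)"
          using rhs[of "N\<^sup>2 + i" l] by (simp add: entries del: index_mult_mat_vec)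
      next
        fix l assume "l < N"
        then show "(\<lambda>m. 1 / real m * (ones_vec m \<bullet> row (Zdot N \<phi> m (\<lambda>k. X k \<omega>) (\<lambda>k. Xdot k \<omega>)) l))
            \<longlonglongrightarrow> ip_L2 \<mu> (\<lambda>_. 1) (grad_dot F \<phi> l)"
          using rhs[of "N\<^sup>2 + N" l] by (simp add: entries)
      next
        fix a b assume "a < aug_dim N" "b < aug_dim N"
        then show "(\<lambda>m. ((1 / real m) \<cdot>\<^sub>m qendy_R N \<phi> m (\<lambda>k. X k \<omega>)) $$ (a, b))
            \<longlonglongrightarrow> limit_R \<mu> N \<phi> $$ (a, b)"
          using gram[of a b] qendy_R_carrier[of N \<phi> _ "\<lambda>k. X k \<omega>"]
          by (simp add: qendy_R_index limit_R_index carrier_matD[OF qendy_R_carrier])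
      next
        fix l a assume "l < N" "a < aug_dim N"
        then show "(\<lambda>m. ((1 / real m) \<cdot>\<^sub>v qendy_s N \<phi> m (\<lambda>k. X k \<omega>) (\<lambda>k. Xdot k \<omega>) l) $ a)
            \<longlonglongrightarrow> limit_s \<mu> N \<phi> F l $ a"
          using rhs[of a l] elim(3)
          by (simp add: qendy_s_index[where F = F] limit_s_index carrier_vecD[OF qendy_s_dim])
      qed
    qed
  next
    show "\<forall>l<N.
      (\<forall>v\<in>carrier_vec (aug_dim N).
        limit_R \<mu> N \<phi> *\<^sub>v v = limit_s \<mu> N \<phi> F l \<longleftrightarrow>
        best_approx (L2 \<mu>) (ip_L2 \<mu>) (aug_dim N) (aug_basis N \<phi>) (grad_dot F \<phi> l)
          (lin_comb (aug_dim N) (aug_basis N \<phi>) v)) \<and>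
      (let v = pinv (limit_R \<mu> N \<phi>) *\<^sub>v limit_s \<mu> N \<phi> F l in
        v \<in> carrier_vec (aug_dim N) \<and>
        limit_R \<mu> N \<phi> *\<^sub>v v = limit_s \<mu> N \<phi> F l \<and>
        best_approx (L2 \<mu>) (ip_L2 \<mu>) (aug_dim N) (aug_basis N \<phi>) (grad_dot F \<phi> l)
          (lin_comb (aug_dim N) (aug_basis N \<phi>) v))"
    proof (intro allI impI)
      fix l assume l: "l < N"
      note gram = L2.gram_system[where p = "aug_dim N" and \<psi> = "aug_basis N \<phi>" and f = "grad_dot F \<phi> l"
          and R = "limit_R \<mu> N \<phi>" and s = "limit_s \<mu> N \<phi> F l" and w = 1 and \<mu> = \<mu>,
          OF aug_L2 grad_L2[OF l] limit_R_carrier _ limit_s_carrier]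
      show "(\<forall>v\<in>carrier_vec (aug_dim N).
        limit_R \<mu> N \<phi> *\<^sub>v v = limit_s \<mu> N \<phi> F l \<longleftrightarrow>
        best_approx (L2 \<mu>) (ip_L2 \<mu>) (aug_dim N) (aug_basis N \<phi>) (grad_dot F \<phi> l)
          (lin_comb (aug_dim N) (aug_basis N \<phi>) v)) \<and>
      (let v = pinv (limit_R \<mu> N \<phi>) *\<^sub>v limit_s \<mu> N \<phi> F l in
        v \<in> carrier_vec (aug_dim N) \<and>
        limit_R \<mu> N \<phi> *\<^sub>v v = limit_s \<mu> N \<phi> F l \<and>
        best_approx (L2 \<mu>) (ip_L2 \<mu>) (aug_dim N) (aug_basis N \<phi>) (grad_dot F \<phi> l)
          (lin_comb (aug_dim N) (aug_basis N \<phi>) v))"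
        unfolding Let_def using gram by (simp add: limit_R_index limit_s_index)
    qed
  next
    \<comment> \<open>A positive state dimension forces \<open>2 \<le> N\<close>, so that two
      distinct indices are available for the dependence.\<close>
    have "0 < CARD('n)" by simp
    then have "2 \<le> N" using N by linarith
    then show "\<exists>c\<in>carrier_vec (aug_dim N).
      c \<noteq> 0\<^sub>v (aug_dim N) \<and> lin_comb (aug_dim N) (aug_basis N \<phi>) c = (\<lambda>_. 0)"
      by (rule aug_basis_dependent)
  next
    show "\<forall>m x xd w. 0 < m \<longrightarrow> 0 < w \<longrightarrow> (\<forall>k<m. xd k = F (x k)) \<longrightarrow>
      (let is_best = (\<lambda>l v. best_approx (R_space m) (ip_discrete m (\<lambda>_. w)) (aug_dim N)
              (\<lambda>a. at_data m x (aug_basis N \<phi> a)) (at_data m x (grad_dot F \<phi> l))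
              (lin_comb (aug_dim N) (\<lambda>a. at_data m x (aug_basis N \<phi> a)) v))
       in
        (\<forall>l<N. \<forall>v\<in>carrier_vec (aug_dim N).
          qendy_R N \<phi> m x *\<^sub>v v = qendy_s N \<phi> m x xd l \<longleftrightarrow> is_best l v) \<and>
        (\<forall>l<N.
          qendy_v N \<phi> m x xd l \<in> carrier_vec (aug_dim N) \<and>
          qendy_R N \<phi> m x *\<^sub>v qendy_v N \<phi> m x xd l = qendy_s N \<phi> m x xd l \<and>
          is_best l (qendy_v N \<phi> m x xd l)) \<and>
        (\<forall>A\<in>carrier_mat N (N\<^sup>2). \<forall>B\<in>carrier_mat N N. \<forall>C\<in>carrier_vec N.
          is_qendy_fit N \<phi> m x xd A B C \<longleftrightarrow>
          (\<forall>l<N. is_best l (block3_vec (row A l) (row B l) (C $ l)))))"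
    proof (intro allI impI)
      fix m :: nat and x xd :: "nat \<Rightarrow> real ^ 'n" and w :: real
      assume w: "0 < w" and "\<forall>k<m. xd k = F (x k)"
      then have xd: "xd k = F (x k)" if "k < m" for k using that by blast
      interpret R: semi_inner_function_space "R_space m" "ip_discrete m (\<lambda>_. w)"
        using w by (intro discrete_semi_inner_function_space) simp
      have ip: "ip_discrete m (\<lambda>_. w) (at_data m x f) (at_data m x g) = w * (\<Sum>k<m. f (x k) * g (x k))" for f g
        by (simp add: ip_discrete_def at_data_def sum_distrib_left mult.commute)
      have sol: "\<forall>v\<in>carrier_vec (aug_dim N). qendy_R N \<phi> m x *\<^sub>v v = qendy_s N \<phi> m x xd l \<longleftrightarrow>
            best_approx (R_space m) (ip_discrete m (\<lambda>_. w)) (aug_dim N)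
              (\<lambda>a. at_data m x (aug_basis N \<phi> a)) (at_data m x (grad_dot F \<phi> l))
              (lin_comb (aug_dim N) (\<lambda>a. at_data m x (aug_basis N \<phi> a)) v)"
          "qendy_v N \<phi> m x xd l \<in> carrier_vec (aug_dim N)"
          "qendy_R N \<phi> m x *\<^sub>v qendy_v N \<phi> m x xd l = qendy_s N \<phi> m x xd l"
        if l: "l < N" for l
      proof -
        note sys = R.gram_system[where p = "aug_dim N" and \<psi> = "\<lambda>a. at_data m x (aug_basis N \<phi> a)"
            and f = "at_data m x (grad_dot F \<phi> l)" and R = "qendy_R N \<phi> m x"
            and s = "qendy_s N \<phi> m x xd l" and w = w,
            OF at_data_mem at_data_mem qendy_R_carrier _ qendy_s_dim]
        have entries: "w * qendy_R N \<phi> m x $$ (i, j)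
            = ip_discrete m (\<lambda>_. w) (at_data m x (aug_basis N \<phi> i)) (at_data m x (aug_basis N \<phi> j))"
            "w * qendy_s N \<phi> m x xd l $ i
            = ip_discrete m (\<lambda>_. w) (at_data m x (aug_basis N \<phi> i)) (at_data m x (grad_dot F \<phi> l))"
          if "i < aug_dim N" "j < aug_dim N" for i j
          unfolding ip using that l xd by (simp_all add: qendy_R_index qendy_s_index[where F = F])
        show "\<forall>v\<in>carrier_vec (aug_dim N). qendy_R N \<phi> m x *\<^sub>v v = qendy_s N \<phi> m x xd l \<longleftrightarrow>
            best_approx (R_space m) (ip_discrete m (\<lambda>_. w)) (aug_dim N)
              (\<lambda>a. at_data m x (aug_basis N \<phi> a)) (at_data m x (grad_dot F \<phi> l))
              (lin_comb (aug_dim N) (\<lambda>a. at_data m x (aug_basis N \<phi> a)) v)"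
          by (intro ballI sys(1)) (use entries w in auto)
        show "qendy_v N \<phi> m x xd l \<in> carrier_vec (aug_dim N)"
          unfolding qendy_v_def by (rule sys(2)) (use entries w in auto)
        show "qendy_R N \<phi> m x *\<^sub>v qendy_v N \<phi> m x xd l = qendy_s N \<phi> m x xd l"
          unfolding qendy_v_def by (rule sys(3)) (use entries w in auto)
      qed
      show "let is_best = (\<lambda>l v. best_approx (R_space m) (ip_discrete m (\<lambda>_. w)) (aug_dim N)
              (\<lambda>a. at_data m x (aug_basis N \<phi> a)) (at_data m x (grad_dot F \<phi> l))
              (lin_comb (aug_dim N) (\<lambda>a. at_data m x (aug_basis N \<phi> a)) v))
       in
        (\<forall>l<N. \<forall>v\<in>carrier_vec (aug_dim N).
          qendy_R N \<phi> m x *\<^sub>v v = qendy_s N \<phi> m x xd l \<longleftrightarrow> is_best l v) \<and>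
        (\<forall>l<N.
          qendy_v N \<phi> m x xd l \<in> carrier_vec (aug_dim N) \<and>
          qendy_R N \<phi> m x *\<^sub>v qendy_v N \<phi> m x xd l = qendy_s N \<phi> m x xd l \<and>
          is_best l (qendy_v N \<phi> m x xd l)) \<and>
        (\<forall>A\<in>carrier_mat N (N\<^sup>2). \<forall>B\<in>carrier_mat N N. \<forall>C\<in>carrier_vec N.
          is_qendy_fit N \<phi> m x xd A B C \<longleftrightarrow>
          (\<forall>l<N. is_best l (block3_vec (row A l) (row B l) (C $ l))))"
        unfolding Let_def
      proof (intro conjI allI impI ballI)
        fix l assume l: "l < N"
        show "qendy_v N \<phi> m x xd l \<in> carrier_vec (aug_dim N)"
          "qendy_R N \<phi> m x *\<^sub>v qendy_v N \<phi> m x xd l = qendy_s N \<phi> m x xd l"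
          using sol[OF l] by auto
        then show "best_approx (R_space m) (ip_discrete m (\<lambda>_. w)) (aug_dim N)
              (\<lambda>a. at_data m x (aug_basis N \<phi> a)) (at_data m x (grad_dot F \<phi> l))
              (lin_comb (aug_dim N) (\<lambda>a. at_data m x (aug_basis N \<phi> a)) (qendy_v N \<phi> m x xd l))"
          using sol(1)[OF l] by blast
      next
        fix l and v :: "real vec" assume "l < N" "v \<in> carrier_vec (aug_dim N)"
        then show "qendy_R N \<phi> m x *\<^sub>v v = qendy_s N \<phi> m x xd l \<longleftrightarrow>
            best_approx (R_space m) (ip_discrete m (\<lambda>_. w)) (aug_dim N)
              (\<lambda>a. at_data m x (aug_basis N \<phi> a)) (at_data m x (grad_dot F \<phi> l))
              (lin_comb (aug_dim N) (\<lambda>a. at_data m x (aug_basis N \<phi> a)) v)"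
          using sol(1) by blast
      next
        fix A B :: "real mat" and C :: "real vec"
        assume "A \<in> carrier_mat N (N\<^sup>2)" "B \<in> carrier_mat N N" "C \<in> carrier_vec N"
        then show "is_qendy_fit N \<phi> m x xd A B C \<longleftrightarrow>
            (\<forall>l<N. best_approx (R_space m) (ip_discrete m (\<lambda>_. w)) (aug_dim N)
              (\<lambda>a. at_data m x (aug_basis N \<phi> a)) (at_data m x (grad_dot F \<phi> l))
              (lin_comb (aug_dim N) (\<lambda>a. at_data m x (aug_basis N \<phi> a)) (block3_vec (row A l) (row B l) (C $ l))))"
          by (rule is_qendy_fit_iff) (rule xd w, assumption?)+
      qed
    qed
  qed
qed

end
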